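(* Let $u_n$ be the number of pairs $(D,c)$ where $D$ is a unicircuit digraph on the labeled vertex set $\{1,\dots,n\}$ and $c$ is a well-coloring of $D$, and let $U(z)=\sum_{n\ge1}u_n z^n/n!$. With $T=C(2z)/2$, $T_r=-C(-C(2z)/2)$, $T_g=T-T_r$ and $T^{unr.}=T-T^2$, \begin{eqnarray*} U(z)&=&T^{unr.}-T_g+\ln\left(\frac{1}{1-(T_g+T\,T_r)}\right)\\ &=&-\frac{C(2z)^2}{4}-C\!\left(-\frac{C(2z)}{2}\right)-\ln\left(1-\frac{C(2z)}{2}-C\!\left(-\frac{C(2z)}{2}\right)+C\!\left(-\frac{C(2z)}{2}\right)\frac{C(2z)}{2}\right)\\ &=&z+4\frac{z^2}{2!}+30\frac{z^3}{3!}+452\frac{z^4}{4!}+8840\frac{z^5}{5!}+224832\frac{z^6}{6!}+6909784\frac{z^7}{7!}+O(z^8), \end{eqnarray*} where $C(z)$ is the Cayley tree function, $C(z)=z\exp(C(z))$.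
   Context: All digraphs are finite, without loops and without multiple arcs (two opposite arcs $(u,v)$ and $(v,u)$ may both be present, forming a circuit of length 2). A child of $u$ is a vertex $v$ with $(u,v)$ an arc. A well-coloring colors each vertex red or green so that every green vertex has at least one red child and no red vertex has a red child (the red vertices then form a kernel). A unicircuit digraph is a connected digraph whose underlying undirected multigraph (a pair of opposite arcs counting as a cycle of length 2) has at most one cycle, and such that this cycle, if present, is a directed circuit; it consists of a directed circuit with trees attached, or of a directed tree. $C(z)=\sum_{n\ge1}n^{n-1}z^n/n!$. Exponential generating functions use $z$ to mark vertices. *)

theory Defs
  imports
    "Graph_Theory.Graph_Theory"
    "HOL-Library.FuncSet"
    "HOL-Computational_Algebra.Formal_Power_Series"
begin

datatype colour = Red | Green

text \<open>
  Colourings are extensional functions on the vertex set, so that they can be counted.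
  The children of \<open>u\<close> are the \<open>v\<close> with \<open>u \<rightarrow>\<^bsub>G\<^esub> v\<close>.
\<close>

definition well_colouring :: "('a, 'b) pre_digraph \<Rightarrow> ('a \<Rightarrow> colour) \<Rightarrow> bool" where
  "well_colouring G c \<longleftrightarrow>
     c \<in> verts G \<rightarrow>\<^sub>E UNIV \<and>
     (\<forall>u \<in> verts G. c u = Green \<longrightarrow> (\<exists>v. u \<rightarrow>\<^bsub>G\<^esub> v \<and> c v = Red)) \<and>
     (\<forall>u \<in> verts G. c u = Red \<longrightarrow> \<not> (\<exists>v. u \<rightarrow>\<^bsub>G\<^esub> v \<and> c v = Red))"

text \<open>
  A cycle of the underlying undirected multigraph of \<open>G\<close>: every arc is an undirected edge, so
  opposite arcs are two parallel edges.  The cycle runs through the pairwise distinct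
  vertices \<open>vs\<close>, using the pairwise distinct edges \<open>es\<close>, each in either direction.
  (The function \<open>mk_symmetric\<close> cannot be used for this, since it identifies opposite arcs.)
\<close>

definition undirected_cycle :: "('a, 'b) pre_digraph \<Rightarrow> 'a list \<Rightarrow> 'b list \<Rightarrow> bool" where
  "undirected_cycle G vs es \<longleftrightarrow>
     es \<noteq> [] \<and> length vs = length es \<and> distinct vs \<and> distinct es \<and> set es \<subseteq> arcs G \<and>
     (\<forall>i < length es.
        {tail G (es ! i), head G (es ! i)} = {vs ! i, vs ! ((i + 1) mod length es)})"

text \<open>
  A cycle as a subgraph is determined by its edge set; starting point and sense of traversal
  are irrelevant when cycles are counted.
\<close>

definition undirected_cycles :: "('a, 'b) pre_digraph \<Rightarrow> 'b set set" where
  "undirected_cycles G = {set es | vs es. undirected_cycle G vs es}"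

definition directed_circuits :: "('a, 'b) pre_digraph \<Rightarrow> 'b set set" where
  "directed_circuits G = {set p | p. pre_digraph.cycle G p}"

definition unicircuit :: "('a, 'b) pre_digraph \<Rightarrow> bool" where
  "unicircuit G \<longleftrightarrow>
     digraph G \<and> connected G \<and>
     (\<forall>X \<in> undirected_cycles G. \<forall>Y \<in> undirected_cycles G. X = Y) \<and>
     undirected_cycles G \<subseteq> directed_circuits G"

definition num_wellcoloured_unicircuit :: "nat \<Rightarrow> nat" where
  "num_wellcoloured_unicircuit n =
     card {(D :: nat pair_pre_digraph, c).
             pverts D = {1..n} \<and> unicircuit (with_proj D) \<and> well_colouring (with_proj D) c}"

definition unicircuit_egf :: "real fps" where
  "unicircuit_egf =
     Abs_fps (\<lambda>n. if n = 0 then 0 else real (num_wellcoloured_unicircuit n) / fact n)"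

definition cayley_fps :: "real fps" where
  "cayley_fps = Abs_fps (\<lambda>n. if n = 0 then 0 else real (n ^ (n - 1)) / fact n)"

text \<open>
  The logarithm of a power series with constant coefficient \<open>1\<close>; \<open>fps_ln 1\<close> is the
  expansion of \<open>ln (1 + z)\<close>.
\<close>

definition fps_log :: "real fps \<Rightarrow> real fps" where
  "fps_log F = fps_ln 1 oo (F - 1)"

end

theory Submission
  imports Defs
begin

text \<open>
  A unicircuit digraph with a chosen starting point on its circuit (for a tree: a chosen root) is a
  core together with a forest rooted at the core whose edges are oriented arbitrarily. By
  inclusion-exclusion over the green vertices without red child, well-colourings become signed
  assignments of three marks to the vertices, subject to a condition on each single arc: red (\<open>Rd\<close>),
  green and required to have no red child (\<open>Barred\<close>, with sign \<open>- 1\<close>), and green without a condition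
  (\<open>Free\<close>). The signed generating functions \<open>X\<^sub>x\<close> of rooted trees with mark \<open>x\<close> at the root are
  \<open>T\<^sub>r\<close>, \<open>- T\<^sub>r\<close> and \<open>T\<close>, respectively. The circuits of length \<open>k\<close> contribute \<open>1/k\<close> times the trace of
  the \<open>k\<close>-th power of the transfer matrix with entries \<open>X\<^sub>x [x \<rightarrow> y allowed]\<close>, whose eigenvalues are
  \<open>T\<close>, \<open>- T\<^sub>r\<close> and \<open>0\<close>, so that they sum up to \<open>- ln (1 - (T\<^sub>g + T T\<^sub>r)) = - ln ((1 - T) (1 + T\<^sub>r))\<close> minus the trace \<open>T\<^sub>g\<close>
  belonging to \<open>k = 1\<close>. The trees contribute \<open>T - T\<^sup>2\<close>, because the number of rooted
  trees is \<open>n\<close> times the number of trees, and \<open>z (T - T\<^sup>2)' = T\<close>.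
\<close>

unbundle fps_syntax

subsection \<open>Power series\<close>

text \<open>Up to the factor \<open>fact j\<close>, the sum is the coefficient of index
  \<open>j\<close> in \<open>exp (x z) (exp z - 1) ^ n\<close>, a series divisible by
  \<open>z ^ n\<close>.\<close>

lemma alternating_binomial_power_sum:
  fixes x :: real
  assumes "j < n"
  shows "(\<Sum>k\<le>n. of_nat (n choose k) * (-1) ^ (n - k) * (x + of_nat k) ^ j) = 0"
proof -
  have "(\<Sum>k\<le>n. of_nat (n choose k) * (fps_exp 1 ^ k * (- 1) ^ (n - k))) = (fps_exp (1::real) - 1) ^ n"
    using binomial_ring[of "fps_exp (1::real)" "-1" n] by (simp add: mult_ac)
  then have "fps_exp x * (fps_exp 1 - 1) ^ n
     = fps_exp x * (\<Sum>k\<le>n. of_nat (n choose k) * (fps_exp 1 ^ k * (- 1) ^ (n - k)))"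
    by simp
  also have "\<dots> = (\<Sum>k\<le>n. fps_const (of_nat (n choose k) * (- 1) ^ (n - k)) * fps_exp (x + of_nat k))"
    by (simp add: sum_distrib_left fps_exp_power_mult fps_exp_add_mult fps_of_nat algebra_simps
          flip: fps_const_mult fps_const_power fps_const_neg)
  finally have "(fps_exp x * (fps_exp 1 - 1) ^ n) $ j
     = (\<Sum>k\<le>n. of_nat (n choose k) * (-1) ^ (n - k) * (x + of_nat k) ^ j) / fact j"
    by (simp add: fps_sum_nth sum_divide_distrib)
  moreover have "(fps_exp x * (fps_exp 1 - 1) ^ n) $ j = 0"
  proof -
    have "fps_exp (1::real) - 1 = fps_X * fps_shift 1 (fps_exp 1)"
      by (rule fps_ext) (auto simp: fps_X_mult_nth)
    then have *: "fps_exp x * (fps_exp 1 - 1) ^ n = fps_X ^ n * (fps_exp x * fps_shift 1 (fps_exp 1) ^ n)"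
      by (simp add: power_mult_distrib mult_ac)
    show ?thesis
      using assms by (subst *) (simp add: fps_X_power_mult_nth)
  qed
  ultimately show ?thesis by simp
qed

text \<open>
  Abel's binomial identity for \<open>x = 1\<close>. Both sides have the same derivative in \<open>y\<close> by induction,
  and at \<open>y = - n - 1\<close> the left-hand side is an \<open>n\<close>-th finite difference of a polynomial
  of degree \<open>n - 1\<close>.
\<close>

lemma abel_binomial:
  fixes y :: real
  shows "(\<Sum>k\<le>n. of_nat (n choose k) * (1 + of_nat k) powi (int k - 1) * (y + of_nat (n - k)) ^ (n - k))
    = (1 + y + of_nat n) ^ n"
proof (induction n arbitrary: y)
  case (Suc n)
  define L where "L = (\<lambda>y::real. \<Sum>k\<le>Suc n. of_nat (Suc n choose k) * (1 + of_nat k) powi (int k - 1)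
     * (y + of_nat (Suc n - k)) ^ (Suc n - k))"
  define D where "D = (\<lambda>y. L y - (1 + y + of_nat (Suc n)) ^ Suc n)"
  have "(L has_real_derivative of_nat (Suc n) * (1 + y + of_nat (Suc n)) ^ n) (at y)" for y
  proof -
    have "(L has_real_derivative (\<Sum>k\<le>Suc n. of_nat (Suc n choose k) * (1 + of_nat k) powi (int k - 1)
       * (of_nat (Suc n - k) * (y + of_nat (Suc n - k)) ^ (Suc n - k - 1)))) (at y)"
      unfolding L_def by (auto intro!: derivative_eq_intros sum.cong)
    also have "(\<Sum>k\<le>Suc n. of_nat (Suc n choose k) * (1 + of_nat k) powi (int k - 1)
       * (of_nat (Suc n - k) * (y + of_nat (Suc n - k)) ^ (Suc n - k - 1)))
      = (\<Sum>k\<le>n. of_nat (Suc n choose k) * (1 + of_nat k) powi (int k - 1)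
       * (of_nat (Suc n - k) * (y + of_nat (Suc n - k)) ^ (Suc n - k - 1)))"
      by simp
    also have "\<dots> = (\<Sum>k\<le>n. of_nat (Suc n) * (of_nat (n choose k) * (1 + of_nat k) powi (int k - 1)
       * ((y + 1) + of_nat (n - k)) ^ (n - k)))"
    proof (intro sum.cong refl)
      fix k assume k: "k \<in> {..n}"
      have "(Suc n choose k) * (Suc n - k) = Suc n * (n choose k)"
        using k binomial_absorb_comp[of "Suc n" k] by (simp add: mult.commute)
      then have eq1: "real (Suc n choose k) * real (Suc n - k) = real (Suc n) * real (n choose k)"
        by (metis of_nat_mult)
      have eq2: "y + real (Suc n - k) = (y + 1) + real (n - k)" "Suc n - k - 1 = n - k"
        using k by (auto simp: of_nat_diff)
      have eq3: "a * p * (r * q) = b * (c * p * q)" if "a * r = b * c" for a b c p q r :: real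
      proof -
        have "a * p * (r * q) = (a * r) * (p * q)" by (simp only: mult_ac)
        then show ?thesis by (simp only: that mult_ac)
      qed
      show "of_nat (Suc n choose k) * (1 + of_nat k) powi (int k - 1)
       * (of_nat (Suc n - k) * (y + of_nat (Suc n - k)) ^ (Suc n - k - 1))
       = of_nat (Suc n) * (of_nat (n choose k) * (1 + of_nat k) powi (int k - 1)
       * ((y + 1) + of_nat (n - k)) ^ (n - k))"
        unfolding eq2 by (rule eq3[OF eq1])
    qed
    also have "\<dots> = of_nat (Suc n) * (1 + (y + 1) + of_nat n) ^ n"
      by (simp only: sum_distrib_left[symmetric] Suc.IH)
    finally show ?thesis by (simp add: add_ac)
  qed
  moreover have "((\<lambda>y. (1 + y + of_nat (Suc n)) ^ Suc n) has_real_derivative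
      of_nat (Suc n) * (1 * (1 + y + of_nat (Suc n)) ^ (Suc n - Suc 0))) (at y)" for y :: real
    by (intro DERIV_power) (auto intro!: derivative_eq_intros)
  ultimately have "(D has_real_derivative 0) (at y)" for y
    unfolding D_def using DERIV_diff by fastforce
  then have c: "D y = D z" for y z
    by (intro DERIV_isconst_all) auto
  \<comment> \<open>This is the point \<open>y = - Suc n - 1\<close>: there each base
    \<open>y + (Suc n - k)\<close> equals \<open>- (1 + k)\<close>, so that the two powers of
    \<open>1 + k\<close> merge into one with exponent \<open>n\<close>, which is smaller than
    \<open>Suc n\<close>.\<close>
  have "L (- of_nat n - 2) = (\<Sum>k\<le>Suc n. of_nat (Suc n choose k) * (-1) ^ (Suc n - k) * (1 + of_nat k) ^ n)"
    unfolding L_def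
  proof (intro sum.cong refl)
    fix k assume k: "k \<in> {..Suc n}"
    have "- real n - 2 + real (Suc n - k) = (-1) * (1 + real k)"
      using k by (simp add: of_nat_diff)
    then have "(- real n - 2 + real (Suc n - k)) ^ (Suc n - k)
      = (-1) ^ (Suc n - k) * (1 + real k) ^ (Suc n - k)"
      by (simp only: power_mult_distrib)
    moreover have "(1 + real k) powi (int k - 1) * (1 + real k) ^ (Suc n - k) = (1 + real k) ^ n"
    proof -
      have "(1 + real k) powi (int k - 1) * (1 + real k) ^ (Suc n - k)
         = (1 + real k) powi (int k - 1 + int (Suc n - k))"
        by (subst power_int_add) (auto simp: add_eq_0_iff)
      also have "int k - 1 + int (Suc n - k) = int n"
        using k by auto
      finally show ?thesis by simp
    qed
    moreover have "a * p * (e * q) = a * e * (p * q)" for a p q e :: real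
      by (simp only: mult_ac)
    ultimately show "of_nat (Suc n choose k) * (1 + of_nat k) powi (int k - 1)
       * (- real n - 2 + of_nat (Suc n - k)) ^ (Suc n - k)
      = of_nat (Suc n choose k) * (-1) ^ (Suc n - k) * (1 + of_nat k) ^ n"
      by (simp only:)
  qed
  also have "\<dots> = 0"
    by (rule alternating_binomial_power_sum) simp
  finally have "D (- of_nat n - 2) = 0"
    by (simp add: D_def)
  then have "D y = 0"
    using c[of y "- of_nat n - 2"] by simp
  then show ?case
    by (simp add: D_def L_def)
qed simp

text \<open>With \<open>P = C / z\<close> and \<open>Q = exp C\<close>, Abel's identity at
  \<open>y = 1\<close> says coefficientwise that \<open>P' = P C'\<close>. The series
  \<open>Q\<close> solves the same equation, and both have constant coefficient \<open>1\<close>, so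
  their quotient is constantly \<open>1\<close>.\<close>

lemma cayley_fps_eq: "cayley_fps = fps_X * (fps_exp 1 oo cayley_fps)"
proof -
  let ?C = cayley_fps
  define P where "P = fps_shift 1 ?C"
  have C0: "?C $ 0 = 0"
    by (simp add: cayley_fps_def)
  have CP: "?C = fps_X * P"
    unfolding P_def by (rule fps_ext) (auto simp: fps_X_mult_nth cayley_fps_def)
  have P_nth: "P $ n = (1 + real n) powi (int n - 1) / fact n" for n
  proof -
    have "P $ n = (1 + real n) ^ n / (fact n * (1 + real n))"
      by (simp add: P_def cayley_fps_def mult_ac)
    also have "(1 + real n) ^ n = (1 + real n) powi (int n - 1) * (1 + real n)"
      using power_int_add_1[of "1 + real n" "int n - 1"] by simp
    finally show ?thesis by simp
  qed
  have dC: "fps_deriv ?C $ n = (1 + real n) ^ n / fact n" for n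
    by (simp add: cayley_fps_def)
  have ode: "fps_deriv P = P * fps_deriv ?C"
  proof (rule fps_ext)
    fix n
    have "(P * fps_deriv ?C) $ n
      = (\<Sum>k\<le>n. (1 + real k) powi (int k - 1) / fact k * ((1 + real (n - k)) ^ (n - k) / fact (n - k)))"
      by (simp only: fps_mult_nth P_nth dC atLeast0AtMost)
    also have "\<dots> = (\<Sum>k\<le>n. of_nat (n choose k) * (1 + of_nat k) powi (int k - 1)
         * (1 + of_nat (n - k)) ^ (n - k)) / fact n"
      unfolding sum_divide_distrib by (intro sum.cong) (auto simp: binomial_fact field_simps)
    also have "\<dots> = (2 + of_nat n) ^ n / fact n"
      using abel_binomial[of n 1] by simp
    also have "\<dots> = fps_deriv P $ n"
      by (simp add: P_nth divide_simps)
    finally show "fps_deriv P $ n = (P * fps_deriv ?C) $ n" ..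
  qed
  define Q where "Q = fps_exp 1 oo ?C"
  have dQ: "fps_deriv Q = Q * fps_deriv ?C"
    unfolding Q_def by (subst fps_compose_deriv) (simp_all add: C0)
  have Q0: "Q $ 0 = 1"
    by (simp add: Q_def)
  have "fps_deriv (P / Q) = 0"
    using Q0 by (subst fps_divide_deriv) (auto simp: ode dQ algebra_simps)
  then have "P / Q = fps_const ((P / Q) $ 0)"
    by (simp add: fps_deriv_eq_0_iff)
  also have "(P / Q) $ 0 = 1"
    using Q0 by (simp add: fps_divide_unit P_nth)
  finally have "P / Q * Q = Q"
    by simp
  then have "P = Q"
    using Q0 by (simp add: fps_divide_unit mult.assoc inverse_mult_eq_1)
  then show ?thesis
    using CP by (simp add: Q_def)
qed

lemma cayley_compose:
  assumes "F $ 0 = 0"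
  shows "cayley_fps oo F = F * (fps_exp 1 oo (cayley_fps oo F))"
proof -
  have "cayley_fps oo F = (fps_X oo F) * ((fps_exp 1 oo cayley_fps) oo F)"
    by (subst cayley_fps_eq) (rule fps_compose_mult_distrib[OF assms])
  also have "(fps_exp 1 oo cayley_fps) oo F = fps_exp 1 oo (cayley_fps oo F)"
    by (rule fps_compose_assoc[symmetric]) (use assms in \<open>simp_all add: cayley_fps_def\<close>)
  finally show ?thesis by (simp add: assms)
qed

text \<open>The quotient of the two sides has derivative \<open>0\<close> and constant coefficient
  \<open>1\<close>.\<close>

lemma fps_exp_compose_add:
  assumes "F $ 0 = 0" "G $ 0 = 0"
  shows "fps_exp 1 oo (F + G) = (fps_exp 1 oo F) * (fps_exp (1::real) oo G)"
proof -
  let ?H = "(fps_exp 1 oo (F + G)) / ((fps_exp 1 oo F) * (fps_exp (1::real) oo G))"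
  have d: "fps_deriv (fps_exp 1 oo K) = (fps_exp 1 oo K) * fps_deriv K" if "K $ 0 = 0" for K :: "real fps"
    using that by (subst fps_compose_deriv) auto
  have nz: "((fps_exp 1 oo F) * (fps_exp (1::real) oo G)) $ 0 = 1"
    using assms by (simp add: fps_compose_nth_0)
  have "fps_deriv ?H = 0"
    using nz assms by (subst fps_divide_deriv) (auto simp: d algebra_simps)
  then have "?H = fps_const (?H $ 0)"
    by (simp add: fps_deriv_eq_0_iff)
  also have "?H $ 0 = 1"
    using nz assms by (simp add: fps_divide_unit fps_compose_nth_0)
  finally have "?H * ((fps_exp 1 oo F) * (fps_exp (1::real) oo G)) = (fps_exp 1 oo F) * (fps_exp (1::real) oo G)"
    by simp
  then show ?thesis
    using nz by (simp add: fps_divide_unit mult.assoc inverse_mult_eq_1)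
qed

section \<open>Logarithms of power series\<close>

lemma fps_log_deriv:
  assumes "F $ 0 = 1"
  shows "fps_deriv (fps_log F) = fps_deriv F * inverse F"
proof -
  have "fps_deriv (fps_log F) = (inverse (1 + fps_X) oo (F - 1)) * fps_deriv (F - 1)"
    unfolding fps_log_def using assms by (subst fps_compose_deriv) (auto simp: fps_ln_deriv)
  also have "inverse (1 + fps_X) oo (F - 1) = inverse F"
    using assms by (subst fps_inverse_compose) (auto simp: fps_compose_add_distrib)
  finally show ?thesis by (simp add: mult.commute)
qed

lemma fps_log_nth_0: "fps_log F $ 0 = 0"
  by (simp add: fps_log_def fps_ln_def)

text \<open>Both sides have derivative \<open>F'/F + G'/G\<close> and constant coefficient
  \<open>0\<close>.\<close>

lemma fps_log_mult:
  assumes "F $ 0 = 1" "G $ 0 = 1"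
  shows "fps_log (F * G) = fps_log F + fps_log G"
proof -
  have "fps_deriv (fps_log (F * G)) = fps_deriv (fps_log F + fps_log G)"
    using assms inverse_mult_eq_1'[of F] inverse_mult_eq_1'[of G]
    by (simp add: fps_log_deriv fps_inverse_mult algebra_simps)
       (simp add: mult.assoc[symmetric] inverse_mult_eq_1 inverse_mult_eq_1')
  then show ?thesis
    by (subst (asm) fps_deriv_eq_iff) (simp add: fps_log_nth_0)
qed

lemma fps_log_1: "fps_log 1 = 0"
  by (simp add: fps_log_def fps_ln_def fps_eq_iff fps_compose_nth)

lemma fps_log_divide:
  assumes "F $ 0 = 1"
  shows "fps_log (1 / F) = - fps_log F"
proof -
  have "fps_log (1 / F) + fps_log F = fps_log (1 / F * F)"
    using assms by (subst fps_log_mult) (auto simp: fps_divide_unit)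
  also have "1 / F * F = 1"
    using assms by (simp add: fps_divide_unit inverse_mult_eq_1)
  finally show ?thesis by (simp add: fps_log_1 add_eq_0_iff2)
qed

text \<open>The signs of the logarithmic series cancel against those of \<open>(- F) ^ k\<close>.
  The sum stops at \<open>n\<close> because \<open>F ^ k\<close> is divisible by
  \<open>z ^ k\<close>.\<close>

lemma fps_log_one_minus_nth:
  assumes "F $ 0 = 0"
  shows "- fps_log (1 - F) $ n = (\<Sum>k=1..n. (F ^ k) $ n / of_nat k)"
proof -
  have "fps_log (1 - F) $ n = (\<Sum>k=0..n. fps_ln 1 $ k * ((- F) ^ k) $ n)"
    by (simp add: fps_log_def fps_compose_nth)
  also have "\<dots> = (\<Sum>k=1..n. fps_ln 1 $ k * ((- F) ^ k) $ n)"
    by (rule sum.mono_neutral_right) (auto simp: fps_ln_def)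
  also have "\<dots> = (\<Sum>k=1..n. - ((F ^ k) $ n / of_nat k))"
  proof (intro sum.cong refl)
    fix k assume k: "k \<in> {1..n}"
    then obtain j where "k = Suc j" by (cases k) auto
    moreover have "(- F) ^ k = fps_const ((-1) ^ k) * F ^ k"
      by (subst power_minus) (simp flip: fps_const_power fps_const_neg)
    moreover have "((-1)::real) ^ j * (-1) ^ j = 1"
      by (simp flip: power_add add: mult_2[symmetric])
    ultimately show "fps_ln 1 $ k * ((- F) ^ k) $ n = - ((F ^ k) $ n / of_nat k)"
      by (simp add: fps_ln_def)
  qed
  finally show ?thesis by (simp add: sum_negf)
qed

subsection \<open>Forests with typed vertices\<close>

text \<open>These are total functions that keep the values of \<open>t\<close> outside
  \<open>B\<close>. In this form an assignment of types can be built in stages, the result of one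
  stage being the base of the next.\<close>

definition ext :: "('a \<Rightarrow> 'k) \<Rightarrow> 'a set \<Rightarrow> ('a \<Rightarrow> 'k) set" where
  "ext t B = {s. \<forall>v. v \<notin> B \<longrightarrow> s v = t v}"

lemma bij_betw_ext:
  "bij_betw (\<lambda>g v. if v \<in> B then g v else t v) (B \<rightarrow>\<^sub>E UNIV) (ext t B)"
  by (rule bij_betw_byWitness[where f' = "\<lambda>s. restrict s B"])
     (auto simp: ext_def fun_eq_iff PiE_def extensional_def)

lemma finite_ext: "finite B \<Longrightarrow> finite (ext (t :: 'a \<Rightarrow> 'k :: finite) B)"
  using bij_betw_finite[OF bij_betw_ext, of B t] by (simp add: finite_PiE)

lemma sum_prod_ext:
  fixes h :: "'a \<Rightarrow> 'k :: finite \<Rightarrow> 'c :: comm_semiring_1"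
  assumes "finite B"
  shows "(\<Sum>s\<in>ext t B. \<Prod>q\<in>B. h q (s q)) = (\<Prod>q\<in>B. \<Sum>x\<in>UNIV. h q x)"
proof -
  have "(\<Sum>s\<in>ext t B. \<Prod>q\<in>B. h q (s q)) = (\<Sum>g\<in>B \<rightarrow>\<^sub>E UNIV. \<Prod>q\<in>B. h q (g q))"
    by (subst sum.reindex_bij_betw[OF bij_betw_ext, symmetric]) (simp cong: prod.cong)
  also have "\<dots> = (\<Prod>q\<in>B. \<Sum>x\<in>UNIV. h q x)"
    using assms by (intro prod_sum_PiE[symmetric]) auto
  finally show ?thesis .
qed

text \<open>Types are chosen on \<open>S\<close> first; the resulting \<open>s'\<close> is then the
  base for the choices on \<open>B\<close>.\<close>

lemma sum_ext_Un:
  fixes h :: "('a \<Rightarrow> 'k :: finite) \<Rightarrow> 'c :: comm_monoid_add"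
  assumes "finite S" "finite B" "S \<inter> B = {}"
  shows "(\<Sum>s\<in>ext t (S \<union> B). h s) = (\<Sum>s'\<in>ext t S. \<Sum>s\<in>ext s' B. h s)"
proof -
  have "(\<Sum>s'\<in>ext t S. \<Sum>s\<in>ext s' B. h s) = (\<Sum>(s', s)\<in>Sigma (ext t S) (\<lambda>s'. ext s' B). h s)"
    by (rule sum.Sigma) (use assms in \<open>auto intro: finite_ext\<close>)
  also have "\<dots> = (\<Sum>s\<in>ext t (S \<union> B). h s)"
    by (rule sum.reindex_bij_witness[where i = "\<lambda>s. (\<lambda>v. if v \<in> S then s v else t v, s)" and j = snd])
       (use assms in \<open>auto simp: ext_def fun_eq_iff disjoint_iff\<close>)
  finally show ?thesis ..
qed

text \<open>
  A forest on \<open>V\<close> with root set \<open>R\<close> is given by its parent function; the rank function \<open>d\<close>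
  expresses that every vertex leads to a root.
\<close>

definition forests :: "'a set \<Rightarrow> 'a set \<Rightarrow> ('a \<Rightarrow> 'a) set" where
  "forests V R = {f \<in> (V - R) \<rightarrow>\<^sub>E V. \<exists>d :: 'a \<Rightarrow> nat. \<forall>q \<in> V - R. d (f q) < d q}"

lemma forestsE:
  assumes "f \<in> forests V R"
  obtains d :: "'a \<Rightarrow> nat" where "\<forall>q \<in> V - R. d (f q) < d q" "\<And>q. q \<in> V - R \<Longrightarrow> f q \<in> V"
proof -
  have "\<exists>d :: 'a \<Rightarrow> nat. \<forall>q \<in> V - R. d (f q) < d q" and f: "f \<in> (V - R) \<rightarrow>\<^sub>E V"
    using assms by (simp_all add: forests_def)
  then obtain d :: "'a \<Rightarrow> nat" where "\<forall>q \<in> V - R. d (f q) < d q"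
    by (elim exE) (rule that)
  then show thesis
    by (rule that) (rule PiE_mem[OF f])
qed

section \<open>Decomposition of forests at a root\<close>

lemma finite_forests: "finite V \<Longrightarrow> finite (forests V R)"
  by (rule finite_subset[of _ "(V - R) \<rightarrow>\<^sub>E V"]) (auto simp: forests_def finite_PiE)

text \<open>A vertex of minimal rank cannot have a parent of smaller rank.\<close>

lemma forests_no_roots:
  assumes "finite V"
  shows "forests V {} = (if V = {} then {\<lambda>_. undefined} else {})"
proof (cases "V = {}")
  case False
  have False if "f \<in> forests V {}" for f
  proof -
    from that obtain d :: "'a \<Rightarrow> nat" where d: "\<forall>q\<in>V. d (f q) < d q" and "f \<in> V \<rightarrow> V"
      by (auto simp: forests_def)
    with arg_min_if_finite[OF assms False, of d] show False
      by (auto simp: Pi_iff)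
  qed
  with False show ?thesis by auto
qed (auto simp: forests_def)

text \<open>Here \<open>S\<close> is the set of children of \<open>p\<close>. Deleting
  \<open>p\<close> makes them roots of a forest on the remaining vertices, and conversely such a
  forest and \<open>S\<close> determine the original one.\<close>

lemma sum_forests_remove_root:
  fixes h :: "('a \<Rightarrow> 'a) \<Rightarrow> 'c :: comm_monoid_add"
  assumes "finite V" "R \<subseteq> V" "p \<in> R"
  shows "(\<Sum>f\<in>forests V R. h f) =
    (\<Sum>S\<in>Pow (V - R). \<Sum>f\<in>forests (V - {p}) (R - {p} \<union> S). h (\<lambda>q. if q \<in> S then p else f q))"
proof -
  have "(\<Sum>S\<in>Pow (V - R). \<Sum>f\<in>forests (V - {p}) (R - {p} \<union> S). h (\<lambda>q. if q \<in> S then p else f q))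
    = (\<Sum>(S, f)\<in>Sigma (Pow (V - R)) (\<lambda>S. forests (V - {p}) (R - {p} \<union> S)). h (\<lambda>q. if q \<in> S then p else f q))"
    using assms by (intro sum.Sigma) (auto intro: finite_forests)
  also have "\<dots> = (\<Sum>f\<in>forests V R. h f)"
  proof (rule sum.reindex_bij_witness[where
          i = "\<lambda>f. ({q \<in> V - R. f q = p}, restrict f {q \<in> V - R. f q \<noteq> p})" and
          j = "\<lambda>(S, f). \<lambda>q. if q \<in> S then p else f q"])
    fix a assume "a \<in> Sigma (Pow (V - R)) (\<lambda>S. forests (V - {p}) (R - {p} \<union> S))"
    then obtain S f where a: "a = (S, f)" and S: "S \<subseteq> V - R"
      and f: "f \<in> forests (V - {p}) (R - {p} \<union> S)" by auto
    from f obtain d :: "'a \<Rightarrow> nat" where f': "f \<in> (V - {p} - (R - {p} \<union> S)) \<rightarrow>\<^sub>E V - {p}"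
      and d: "\<forall>q \<in> V - {p} - (R - {p} \<union> S). d (f q) < d q"
      by (auto simp: forests_def)
    have eq: "V - {p} - (R - {p} \<union> S) = V - R - S" using assms by auto
    have out: "f q = undefined" if "q \<notin> V - R - S" for q
      using f' that unfolding eq PiE_def extensional_def by blast
    have inn: "f q \<in> V" "f q \<noteq> p" if "q \<in> V - R - S" for q
      using f' that unfolding eq by auto
    have "{q \<in> V - R. (if q \<in> S then p else f q) = p} = S"
      using S inn by (auto split: if_splits)
    moreover have "restrict (\<lambda>q. if q \<in> S then p else f q)
        {q \<in> V - R. (if q \<in> S then p else f q) \<noteq> p} = f"
    proof
      fix q
      show "restrict (\<lambda>q. if q \<in> S then p else f q)
        {q \<in> V - R. (if q \<in> S then p else f q) \<noteq> p} q = f q"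
        using S inn[of q] out[of q] by (cases "q \<in> V - R - S") auto
    qed
    ultimately show "({q \<in> V - R. (case a of (S, f) \<Rightarrow> \<lambda>q. if q \<in> S then p else f q) q = p},
       restrict (case a of (S, f) \<Rightarrow> \<lambda>q. if q \<in> S then p else f q)
        {q \<in> V - R. (case a of (S, f) \<Rightarrow> \<lambda>q. if q \<in> S then p else f q) q \<noteq> p}) = a"
      by (simp add: a)
    have "(\<lambda>q. if q \<in> S then p else f q) \<in> forests V R"
      unfolding forests_def
    \<comment> \<open>The vertex \<open>p\<close> becomes the only one of rank \<open>0\<close>;
      lifting all other ranks by one keeps the old inequalities and puts the vertices of
      \<open>S\<close> above \<open>p\<close>.\<close>
    proof (intro CollectI conjI exI[of _ "\<lambda>v. if v = p then 0 else Suc (d v)"] ballI)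
      show "(\<lambda>q. if q \<in> S then p else f q) \<in> (V - R) \<rightarrow>\<^sub>E V"
        using assms S inn out by (auto simp: PiE_def extensional_def)
      fix q assume "q \<in> V - R"
      then show "(if (if q \<in> S then p else f q) = p then 0 else Suc (d (if q \<in> S then p else f q)))
        < (if q = p then 0 else Suc (d q))"
        using assms d unfolding eq by auto
    qed
    then show "(case a of (S, f) \<Rightarrow> \<lambda>q. if q \<in> S then p else f q) \<in> forests V R"
      by (simp add: a)
    show "h (case a of (S, f) \<Rightarrow> \<lambda>q. if q \<in> S then p else f q)
      = (case a of (S, f) \<Rightarrow> h (\<lambda>q. if q \<in> S then p else f q))"
      by (simp add: a)
  next
    fix f assume "f \<in> forests V R"
    then obtain d :: "'a \<Rightarrow> nat" where f: "f \<in> (V - R) \<rightarrow>\<^sub>E V"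
      and d: "\<forall>q \<in> V - R. d (f q) < d q"
      by (auto simp: forests_def)
    show "(case ({q \<in> V - R. f q = p}, restrict f {q \<in> V - R. f q \<noteq> p}) of
      (S, f) \<Rightarrow> \<lambda>q. if q \<in> S then p else f q) = f"
      by (rule ext) (use f in \<open>auto simp: PiE_def extensional_def\<close>)
    have eq: "V - {p} - (R - {p} \<union> {q \<in> V - R. f q = p}) = {q \<in> V - R. f q \<noteq> p}"
      using assms by auto
    have "restrict f {q \<in> V - R. f q \<noteq> p} \<in> forests (V - {p}) (R - {p} \<union> {q \<in> V - R. f q = p})"
      unfolding forests_def eq
      by (intro CollectI conjI exI[of _ d]) (use f d in auto)
    then show "({q \<in> V - R. f q = p}, restrict f {q \<in> V - R. f q \<noteq> p})
      \<in> Sigma (Pow (V - R)) (\<lambda>S. forests (V - {p}) (R - {p} \<union> S))"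
      by auto
  qed
  finally show ?thesis ..
qed

lemma sum_Pow_card:
  fixes h :: "nat \<Rightarrow> 'c :: comm_semiring_1"
  assumes "finite A"
  shows "(\<Sum>S\<in>Pow A. h (card S)) = (\<Sum>k\<le>card A. of_nat (card A choose k) * h k)"
proof -
  have "(\<Sum>k\<le>card A. of_nat (card A choose k) * h k) =
      (\<Sum>k\<le>card A. \<Sum>S\<in>{S\<in>Pow A. card S = k}. h (card S))"
    using n_subsets[OF assms] by (intro sum.cong) (auto simp: Pow_def)
  also have "\<dots> = (\<Sum>S\<in>Pow A. h (card S))"
    by (rule sum.group) (use assms in \<open>auto intro: card_mono\<close>)
  finally show ?thesis ..
qed

lemma fps_mult_exp_compose_nth:
  fixes G H :: "real fps"
  assumes "G $ 0 = 0"
  shows "(H * (fps_exp 1 oo G)) $ m = (\<Sum>k\<le>m. (H * G ^ k) $ m / fact k)"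
proof -
  \<comment> \<open>One bound \<open>m\<close> serves all coefficients up to \<open>m\<close>, so
    that the two sums can be exchanged below; the added terms vanish because \<open>G ^ k\<close>
    starts at index \<open>k\<close>.\<close>
  have *: "(fps_exp 1 oo G) $ j = (\<Sum>k\<le>m. (G ^ k) $ j / fact k)" if "j \<le> m" for j
  proof -
    have "(\<Sum>k\<le>m. (G ^ k) $ j / fact k) = (\<Sum>k\<le>j. (G ^ k) $ j / fact k)"
      by (rule sum.mono_neutral_right) (use that assms in \<open>auto simp: startsby_zero_power_prefix\<close>)
    then show ?thesis by (simp add: fps_compose_nth atLeast0AtMost)
  qed
  have "(H * (fps_exp 1 oo G)) $ m = (\<Sum>i=0..m. H $ i * (\<Sum>k\<le>m. (G ^ k) $ (m - i) / fact k))"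
    by (simp add: fps_mult_nth *)
  also have "\<dots> = (\<Sum>k\<le>m. \<Sum>i=0..m. H $ i * ((G ^ k) $ (m - i) / fact k))"
    by (simp add: sum_distrib_left sum.swap[of _ "{0..m}"])
  also have "\<dots> = (\<Sum>k\<le>m. (H * G ^ k) $ m / fact k)"
    by (simp add: fps_mult_nth sum_divide_distrib)
  finally show ?thesis .
qed

text \<open>
  The weight \<open>w x y\<close> belongs to an edge from a parent of type \<open>x\<close> to a child of type \<open>y\<close>, and
  \<open>E x\<close> enumerates the trees with a root of type \<open>x\<close>, the root itself not being counted. The proof is
  by induction on \<open>V\<close>: removing one root turns its children into roots.
\<close>

lemma forest_sum:
  fixes w :: "'k :: finite \<Rightarrow> 'k \<Rightarrow> real" and E :: "'k \<Rightarrow> real fps"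
  assumes E: "\<And>x. E x = fps_exp 1 oo (\<Sum>y\<in>UNIV. fps_const (w x y) * (fps_X * E y))"
  assumes "finite V" "R \<subseteq> V"
  shows "(\<Sum>f\<in>forests V R. \<Sum>s\<in>ext t (V - R). \<Prod>q\<in>V - R. w (s (f q)) (s q))
    = fact (card (V - R)) * (\<Prod>p\<in>R. E (t p)) $ card (V - R)"
  using assms(2,3)
proof (induction "card V" arbitrary: V R t rule: less_induct)
  case less
  note fin = less.prems(1)
  show ?case
  proof (cases "R = {}")
    case True
    then show ?thesis
      using fin by (auto simp: forests_no_roots fps_one_nth ext_def simp flip: fun_eq_iff)
  next
    case False
    then obtain p where p: "p \<in> R" by auto
    define A where "A = V - R"
    have finA: "finite A" and pA: "p \<notin> A" and finR: "finite R"
      using fin p less.prems finite_subset by (auto simp: A_def)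
    define m where "m = card A"
    \<comment> \<open>The series \<open>fps_X * G\<close> enumerates one subtree hanging from
      \<open>p\<close>, and \<open>H\<close> belongs to the other roots. By \<open>E\<close>, the
      exponential of \<open>fps_X * G\<close> is \<open>E (t p)\<close>.\<close>
    define G where "G = (\<Sum>y\<in>UNIV. fps_const (w (t p) y) * E y)"
    define H where "H = (\<Prod>p'\<in>R - {p}. E (t p'))"
    have XG: "(\<Sum>y\<in>UNIV. fps_const (w (t p) y) * (fps_X * E y)) = fps_X * G"
      by (simp add: G_def sum_distrib_left algebra_simps)
    \<comment> \<open>For a fixed set \<open>S\<close> of children of \<open>p\<close>, the
      induction hypothesis is applied for every assignment \<open>s'\<close> of types to
      \<open>S\<close>; summing over \<open>s'\<close> then yields one factor \<open>G\<close> per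
      child.\<close>
    have step: "(\<Sum>f\<in>forests (V - {p}) (R - {p} \<union> S). \<Sum>s\<in>ext t A. \<Prod>q\<in>A.
         w (s (if q \<in> S then p else f q)) (s q))
       = fact (m - card S) * (H * G ^ card S) $ (m - card S)" (is "?L = _") if S: "S \<in> Pow A" for S
    proof -
      have S': "S \<subseteq> A" "finite S" "p \<notin> S" "R \<inter> S = {}"
        using S finA pA finite_subset by (auto simp: A_def)
      have eq: "V - {p} - (R - {p} \<union> S) = A - S"
        using p less.prems by (auto simp: A_def)
      have IH: "(\<Sum>f\<in>forests (V - {p}) (R - {p} \<union> S). \<Sum>s\<in>ext s' (A - S). \<Prod>q\<in>A - S. w (s (f q)) (s q))
        = fact (card (A - S)) * (\<Prod>p'\<in>R - {p} \<union> S. E (s' p')) $ card (A - S)" for s'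
        unfolding eq[symmetric]
        by (rule less.hyps) (use fin p less.prems S' in \<open>auto simp: A_def intro: psubset_card_mono\<close>)
      have prod_split: "(\<Prod>q\<in>A. w (s (if q \<in> S then p else f q)) (s q))
        = (\<Prod>q\<in>S. w (t p) (s' q)) * (\<Prod>q\<in>A - S. w (s (f q)) (s q))"
        if "s' \<in> ext t S" "s \<in> ext s' (A - S)" for s s' f
      proof -
        have "s p = t p" using that pA S' by (auto simp: ext_def)
        moreover have "s q = s' q" if "q \<in> S" for q
          using that \<open>s \<in> ext s' (A - S)\<close> by (auto simp: ext_def)
        ultimately show ?thesis
          using S' finA by (subst prod.subset_diff[of S A]) (auto intro!: arg_cong2[of _ _ _ _ "(*)"] prod.cong)
      qed
      have "?L = (\<Sum>f\<in>forests (V - {p}) (R - {p} \<union> S). \<Sum>s\<in>ext t (S \<union> (A - S)). \<Prod>q\<in>A.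
         w (s (if q \<in> S then p else f q)) (s q))"
        using S' by (simp add: Un_absorb1)
      also have "\<dots> = (\<Sum>f\<in>forests (V - {p}) (R - {p} \<union> S). \<Sum>s'\<in>ext t S. \<Sum>s\<in>ext s' (A - S).
         (\<Prod>q\<in>S. w (t p) (s' q)) * (\<Prod>q\<in>A - S. w (s (f q)) (s q)))"
        using S' finA by (subst sum_ext_Un) (auto intro!: sum.cong prod_split)
      also have "\<dots> = (\<Sum>s'\<in>ext t S. (\<Prod>q\<in>S. w (t p) (s' q)) *
         (\<Sum>f\<in>forests (V - {p}) (R - {p} \<union> S). \<Sum>s\<in>ext s' (A - S). \<Prod>q\<in>A - S. w (s (f q)) (s q)))"
        by (subst sum.swap) (simp add: sum_distrib_left)
      also have "\<dots> = (\<Sum>s'\<in>ext t S. fact (m - card S) *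
          (fps_const (\<Prod>q\<in>S. w (t p) (s' q)) * (\<Prod>p'\<in>R - {p} \<union> S. E (s' p'))) $ (m - card S))"
        unfolding IH using S' finA by (simp add: card_Diff_subset m_def mult_ac)
      also have "\<dots> = (\<Sum>s'\<in>ext t S. fact (m - card S) *
          (H * (\<Prod>q\<in>S. fps_const (w (t p) (s' q)) * E (s' q))) $ (m - card S))"
      proof (intro sum.cong refl arg_cong[where f = "\<lambda>F. fact (m - card S) * F $ (m - card S)"])
        fix s' assume s': "s' \<in> ext t S"
        have "(\<Prod>p'\<in>R - {p} \<union> S. E (s' p')) = (\<Prod>p'\<in>R - {p}. E (s' p')) * (\<Prod>p'\<in>S. E (s' p'))"
          using S' finR by (subst prod.union_disjoint) auto
        also have "(\<Prod>p'\<in>R - {p}. E (s' p')) = H"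
          unfolding H_def using s' S' by (intro prod.cong) (auto simp: ext_def)
        finally have "(\<Prod>p'\<in>R - {p} \<union> S. E (s' p')) = H * (\<Prod>p'\<in>S. E (s' p'))" .
        moreover have "fps_const (\<Prod>q\<in>S. w (t p) (s' q)) = (\<Prod>q\<in>S. fps_const (w (t p) (s' q)))"
          by (induction S rule: infinite_finite_induct) (auto simp flip: fps_const_mult)
        ultimately show "fps_const (\<Prod>q\<in>S. w (t p) (s' q)) * (\<Prod>p'\<in>R - {p} \<union> S. E (s' p'))
          = H * (\<Prod>q\<in>S. fps_const (w (t p) (s' q)) * E (s' q))"
          by (simp add: prod.distrib mult_ac)
      qed
      also have "\<dots> = fact (m - card S) *
          (H * (\<Sum>s'\<in>ext t S. \<Prod>q\<in>S. fps_const (w (t p) (s' q)) * E (s' q))) $ (m - card S)"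
        by (simp add: sum_distrib_left fps_sum_nth)
      also have "(\<Sum>s'\<in>ext t S. \<Prod>q\<in>S. fps_const (w (t p) (s' q)) * E (s' q)) = G ^ card S"
        using sum_prod_ext[OF S'(2), of "\<lambda>q x. fps_const (w (t p) x) * E x" t] by (simp add: G_def)
      finally show ?thesis .
    qed
    have "(\<Sum>f\<in>forests V R. \<Sum>s\<in>ext t A. \<Prod>q\<in>A. w (s (f q)) (s q))
      = (\<Sum>S\<in>Pow A. fact (m - card S) * (H * G ^ card S) $ (m - card S))"
      using step by (subst sum_forests_remove_root[OF fin less.prems(2) p]) (simp flip: A_def)
    also have "\<dots> = (\<Sum>k\<le>m. of_nat (m choose k) * (fact (m - k) * (H * G ^ k) $ (m - k)))"
      unfolding m_def by (rule sum_Pow_card[OF finA])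
    \<comment> \<open>The binomial coefficient and \<open>fact (m - k)\<close> combine to
      \<open>fact m / fact k\<close>, and the \<open>k\<close> children of \<open>p\<close> account
      for the index shift by \<open>fps_X ^ k\<close>.\<close>
    also have "\<dots> = (\<Sum>k\<le>m. fact m * ((H * (fps_X * G) ^ k) $ m / fact k))"
    proof (intro sum.cong refl)
      fix k assume k: "k \<in> {..m}"
      have *: "H * (fps_X * G) ^ k = fps_X ^ k * (H * G ^ k)"
        by (simp add: power_mult_distrib algebra_simps)
      have "(H * (fps_X * G) ^ k) $ m = (H * G ^ k) $ (m - k)"
        using k by (subst *) (simp add: fps_X_power_mult_nth)
      then show "of_nat (m choose k) * (fact (m - k) * (H * G ^ k) $ (m - k))
        = fact m * ((H * (fps_X * G) ^ k) $ m / fact k)"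
        using k by (simp add: binomial_fact field_simps)
    qed
    also have "\<dots> = fact m * (H * (fps_exp 1 oo (fps_X * G))) $ m"
      by (subst fps_mult_exp_compose_nth) (auto simp: sum_distrib_left)
    also have "H * (fps_exp 1 oo (fps_X * G)) = (\<Prod>p\<in>R. E (t p))"
      unfolding XG[symmetric] E[symmetric] H_def
      using p finR by (simp add: prod.remove[of R p] mult.commute)
    finally show ?thesis by (simp add: A_def m_def)
  qed
qed

subsection \<open>Digraphs consisting of a core and a forest\<close>

lemma digraph_with_proj_iff:
  "digraph (with_proj D) \<longleftrightarrow>
     finite (pverts D) \<and> parcs D \<subseteq> pverts D \<times> pverts D \<and> (\<forall>e\<in>parcs D. fst e \<noteq> snd e)"
proof
  assume "digraph (with_proj D)"
  then interpret digraph "with_proj D" .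
  show "finite (pverts D) \<and> parcs D \<subseteq> pverts D \<times> pverts D \<and> (\<forall>e\<in>parcs D. fst e \<noteq> snd e)"
    using finite_verts tail_in_verts head_in_verts no_loops by auto
next
  assume *: "finite (pverts D) \<and> parcs D \<subseteq> pverts D \<times> pverts D \<and> (\<forall>e\<in>parcs D. fst e \<noteq> snd e)"
  then have "finite (parcs D)"
    by (meson finite_SigmaI finite_subset)
  with * show "digraph (with_proj D)"
    by unfold_locales (auto simp: arc_to_ends_def)
qed

lemma connected_with_proj_iff:
  assumes "parcs D \<subseteq> pverts D \<times> pverts D"
  shows "connected (with_proj D) \<longleftrightarrow>
     pverts D \<noteq> {} \<and> (\<forall>u\<in>pverts D. \<forall>v\<in>pverts D. (u, v) \<in> (parcs D \<union> (parcs D)\<inverse>)\<^sup>*)"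
proof -
  have eq: "parcs (mk_symmetric (with_proj D)) = parcs D \<union> (parcs D)\<inverse>"
    by (auto simp: parcs_mk_symmetric)
  have "(u, v) \<in> rtrancl_on (pverts D) (parcs D \<union> (parcs D)\<inverse>)
      \<longleftrightarrow> (u, v) \<in> (parcs D \<union> (parcs D)\<inverse>)\<^sup>*" if "u \<in> pverts D" "v \<in> pverts D" for u v
    using that assms by (auto intro: rtrancl_on_rtranclI rtrancl_consistent_rtrancl_on)
  then show ?thesis
    by (auto simp: connected_def strongly_connected_def reachable_def eq)
qed

lemma undirected_cycle_with_proj:
  "undirected_cycle (with_proj D) ws es \<longleftrightarrow>
     es \<noteq> [] \<and> length ws = length es \<and> distinct ws \<and> distinct es \<and> set es \<subseteq> parcs D \<and>
     (\<forall>i < length es. {fst (es ! i), snd (es ! i)} = {ws ! i, ws ! (Suc i mod length es)})"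
  by (simp add: undirected_cycle_def)

text \<open>Without loops a cycle has length at least two, so the edges at a position and at its
  cyclic predecessor are different; they share the vertex at that position.\<close>

lemma undirected_cycle_incident:
  assumes cyc: "undirected_cycle (with_proj D) ws es" and loopfree: "\<forall>e\<in>parcs D. fst e \<noteq> snd e"
    and x: "x \<in> set ws"
  obtains e e' where "e \<in> set es" "e' \<in> set es" "e \<noteq> e'" "x \<in> {fst e, snd e}" "x \<in> {fst e', snd e'}"
proof -
  let ?n = "length es"
  have cyc': "es \<noteq> []" "length ws = ?n" "distinct ws" "distinct es" "set es \<subseteq> parcs D"
     "\<And>i. i < ?n \<Longrightarrow> {fst (es ! i), snd (es ! i)} = {ws ! i, ws ! (Suc i mod ?n)}"
    using cyc by (auto simp: undirected_cycle_with_proj)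
  have "?n \<noteq> 1"
  proof
    assume "?n = 1"
    with cyc'(6)[of 0] have "fst (es ! 0) = snd (es ! 0)"
      by (auto simp: doubleton_eq_iff)
    moreover have "es ! 0 \<in> parcs D"
      using cyc' by (metis length_greater_0_conv nth_mem subsetD)
    ultimately show False using loopfree by auto
  qed
  with cyc' have n: "?n \<ge> 2"
    by (cases es) (auto simp: Suc_le_eq)
  obtain i where i: "i < ?n" "x = ws ! i"
    using x cyc'(2) by (metis in_set_conv_nth)
  define j where "j = (if i = 0 then ?n - 1 else i - 1)"
  have j: "j < ?n" "Suc j mod ?n = i" "j \<noteq> i"
    using i n by (auto simp: j_def)
  show thesis
  proof
    show "es ! i \<in> set es" "es ! j \<in> set es"
      using i j by auto
    show "es ! i \<noteq> es ! j"
      using i j cyc'(4) by (simp add: nth_eq_iff_index_eq)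
    show "x \<in> {fst (es ! i), snd (es ! i)}" "x \<in> {fst (es ! j), snd (es ! j)}"
      using cyc'(6) i j by auto
  qed
qed

lemma undirected_cycle_ends:
  assumes "undirected_cycle (with_proj D) ws es" "e \<in> set es"
  shows "fst e \<in> set ws" "snd e \<in> set ws"
proof -
  obtain i where i: "i < length es" "e = es ! i"
    using assms(2) by (metis in_set_conv_nth)
  then have eq: "{fst e, snd e} = {ws ! i, ws ! (Suc i mod length es)}" and len: "length ws = length es"
    using assms(1) by (auto simp: undirected_cycle_with_proj)
  have "Suc i mod length es < length es"
    using i by (intro mod_less_divisor) auto
  then have "{fst e, snd e} \<subseteq> set ws"
    unfolding eq using i len by auto
  then show "fst e \<in> set ws" "snd e \<in> set ws" by auto
qed

text \<open>When a new first vertex already occurs on the path, the part before that occurrence is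
  cut off.\<close>

lemma rtrancl_distinct_path:
  assumes "(x, y) \<in> S\<^sup>*"
  shows "\<exists>ws. ws \<noteq> [] \<and> hd ws = x \<and> last ws = y \<and> distinct ws \<and> successively (\<lambda>a b. (a, b) \<in> S) ws"
  using assms
proof (induction rule: converse_rtrancl_induct)
  case base
  then show ?case by (intro exI[of _ "[y]"]) auto
next
  case (step x z)
  then obtain ws where ws: "ws \<noteq> []" "hd ws = z" "last ws = y" "distinct ws"
    "successively (\<lambda>a b. (a, b) \<in> S) ws" by auto
  show ?case
  proof (cases "x \<in> set ws")
    case True
    then obtain as bs where "ws = as @ x # bs" by (metis split_list)
    with ws show ?thesis
      by (intro exI[of _ "x # bs"]) (auto simp: successively_append_iff split: if_splits)
  next
    case False
    with ws step show ?thesis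
      by (intro exI[of _ "x # ws"]) (auto simp: successively_Cons)
  qed
qed

text \<open>A simple undirected path in \<open>G\<close> from \<open>y\<close> to \<open>x\<close>
  is closed by the arc \<open>(x, y)\<close>. If the path is the single opposite arc
  \<open>(y, x)\<close>, the cycle has length two.\<close>

lemma undirected_cycle_closing_arc:
  assumes G: "G \<subseteq> parcs D" and e: "(x, y) \<in> parcs D - G" "x \<noteq> y" and path: "(y, x) \<in> (G \<union> G\<inverse>)\<^sup>*"
  obtains X where "X \<in> undirected_cycles (with_proj D)" "(x, y) \<in> X"
proof -
  obtain ws where ws: "ws \<noteq> []" "hd ws = y" "last ws = x" "distinct ws"
    "successively (\<lambda>a b. (a, b) \<in> G \<union> G\<inverse>) ws"
    using rtrancl_distinct_path[OF path] by auto
  obtain m where m: "length ws = Suc m"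
    using ws(1) by (cases ws) auto
  have step: "(ws ! i, ws ! Suc i) \<in> G \<union> G\<inverse>" if "i < m" for i
    using ws(5) that m by (auto simp: successively_conv_nth)
  \<comment> \<open>The path is undirected: \<open>a i\<close> is an arc of \<open>G\<close> that
    realises its \<open>i\<close>-th edge, in whichever direction is present.\<close>
  define a where "a i = (if (ws ! i, ws ! Suc i) \<in> G then (ws ! i, ws ! Suc i) else (ws ! Suc i, ws ! i))" for i
  have aG: "a i \<in> G" if "i < m" for i
    using step[OF that] by (auto simp: a_def)
  have a_ends: "{fst (a i), snd (a i)} = {ws ! i, ws ! Suc i}" for i
    by (auto simp: a_def)
  have a_inj: "i = j" if "i < m" "j < m" "a i = a j" for i j
  proof -
    have "{ws ! i, ws ! Suc i} = {ws ! j, ws ! Suc j}"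
      using a_ends that(3) by metis
    then show ?thesis
      using that ws(4) m by (auto simp: doubleton_eq_iff nth_eq_iff_index_eq)
  qed
  define es where "es = map a [0..<m] @ [(x, y)]"
  have len: "length es = Suc m" by (simp add: es_def)
  have "undirected_cycle (with_proj D) ws es"
    unfolding undirected_cycle_with_proj
  proof (intro conjI allI impI)
    show "distinct es"
      using aG e a_inj by (auto simp: es_def distinct_map inj_on_def)
    show "set es \<subseteq> parcs D"
      using aG e G by (auto simp: es_def)
    fix i assume "i < length es"
    then consider "i < m" | "i = m" using len by linarith
    then show "{fst (es ! i), snd (es ! i)} = {ws ! i, ws ! (Suc i mod length es)}"
    proof cases
      case 1
      then show ?thesis
        using a_ends[of i] by (simp add: es_def nth_append)
    next
      case 2
      moreover have "ws ! 0 = y" "ws ! m = x"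
        using ws m by (auto simp: hd_conv_nth last_conv_nth)
      ultimately show ?thesis
        by (auto simp: es_def nth_append)
    qed
  qed (use ws len m in \<open>auto simp: es_def\<close>)
  then have "set es \<in> undirected_cycles (with_proj D)"
    unfolding undirected_cycles_def by blast
  then show thesis
    by (rule that) (simp add: es_def)
qed

text \<open>
  A core is a directed circuit, given by the list of its vertices. A one-element list stands for the
  chosen root of a tree and has no arcs.
\<close>

definition core_arcs :: "'a list \<Rightarrow> ('a \<times> 'a) set" where
  "core_arcs vs = (if length vs = 1 then {} else set (zip vs (rotate1 vs)))"

section \<open>Directed circuits as lists of vertices\<close>

lemma core_arcs_conv_nth:
  assumes "length vs \<noteq> 1"
  shows "core_arcs vs = (\<lambda>i. (vs ! i, vs ! (Suc i mod length vs))) ` {..<length vs}"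
  using assms by (auto simp: core_arcs_def set_zip nth_rotate1)

lemma core_arcs_subset: "core_arcs vs \<subseteq> set vs \<times> set vs"
  by (auto simp: core_arcs_def dest: set_zip_leftD set_zip_rightD)

lemma core_arcs_loopfree:
  assumes "distinct vs" "e \<in> core_arcs vs"
  shows "fst e \<noteq> snd e"
proof -
  have len: "length vs \<noteq> 1"
    using assms(2) by (auto simp: core_arcs_def)
  then obtain i where i: "i < length vs" "e = (vs ! i, vs ! (Suc i mod length vs))"
    using assms by (auto simp: core_arcs_conv_nth)
  have "Suc i mod length vs \<noteq> i" "Suc i mod length vs < length vs"
    using i len by (auto simp: mod_Suc)
  with i assms(1) show ?thesis
    by (simp add: nth_eq_iff_index_eq)
qed

lemma pcas_zip:
  "pcas x (zip (x # xs) (xs @ [y])) y \<and> pawalk_verts x (zip (x # xs) (xs @ [y])) = x # xs @ [y]"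
  by (induction xs arbitrary: x) auto

lemma pcas_imp_zip:
  assumes "pcas u p v" "p \<noteq> []"
  shows "p = zip (map fst p) (tl (map fst p) @ [v])" "pawalk_verts u p = map fst p @ [v]"
    "hd (map fst p) = u"
  using assms
proof (induction p arbitrary: u)
  case (Cons e p)
  { case 1 with Cons show ?case by (cases p; cases e) auto }
  { case 2 with Cons show ?case by (cases p; cases e) auto }
  { case 3 with Cons show ?case by simp }
qed auto

lemma core_arcs_directed_circuit:
  assumes "distinct vs" "length vs \<ge> 2" "set vs \<subseteq> pverts D" "core_arcs vs \<subseteq> parcs D"
  shows "core_arcs vs \<in> directed_circuits (with_proj D)"
proof -
  obtain x xs where vs: "vs = x # xs" "xs \<noteq> []"
    using assms(2) by (cases vs) (auto simp: Suc_le_eq)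
  let ?p = "zip (x # xs) (xs @ [x])"
  have p: "core_arcs vs = set ?p"
    using vs by (auto simp: core_arcs_def)
  have "pre_digraph.cycle (with_proj D) ?p"
    unfolding pre_digraph.cycle_def pre_digraph.awalk_def cas_with_proj_eq awalk_verts_with_proj_eq
    using pcas_zip[of x xs x] assms p vs by (intro exI[of _ x]) auto
  then show ?thesis
    unfolding directed_circuits_def p by auto
qed

text \<open>The list consists of the tails of the arcs in the order of the walk; it has at least two
  entries because there are no loops.\<close>

lemma directed_circuit_imp_core_arcs:
  assumes "X \<in> directed_circuits (with_proj D)" "digraph (with_proj D)"
  obtains vs where "distinct vs" "length vs \<ge> 2" "set vs \<subseteq> pverts D" "core_arcs vs = X" "X \<subseteq> parcs D"
proof -
  obtain p u where p: "X = set p" "p \<noteq> []" "set p \<subseteq> parcs D" "pcas u p u"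
    "distinct (tl (pawalk_verts u p))"
    using assms(1)
    by (auto simp: directed_circuits_def pre_digraph.cycle_def pre_digraph.awalk_def
        cas_with_proj_eq awalk_verts_with_proj_eq)
  define vs where "vs = map fst p"
  obtain xs where vs: "vs = u # xs"
    using pcas_imp_zip(3)[OF p(4,2)] p(2) by (cases vs) (auto simp: vs_def)
  have pz: "p = zip vs (xs @ [u])"
    using pcas_imp_zip(1)[OF p(4,2)] unfolding vs_def[symmetric] vs by simp
  have "pawalk_verts u p = vs @ [u]"
    using pcas_imp_zip(2)[OF p(4,2)] by (simp add: vs_def)
  with p(5) have dist: "distinct vs"
    by (auto simp: vs)
  have "xs \<noteq> []"
  proof
    assume "xs = []"
    then have "(u, u) \<in> parcs D" using pz vs p(3) by auto
    then show False using assms(2) by (auto simp: digraph_with_proj_iff)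
  qed
  show thesis
  proof
    show "set vs \<subseteq> pverts D"
      using p(3) assms(2) by (auto simp: vs_def digraph_with_proj_iff)
    show "core_arcs vs = X"
      using \<open>xs \<noteq> []\<close> pz by (auto simp: core_arcs_def vs p(1))
    show "length vs \<ge> 2"
      using \<open>xs \<noteq> []\<close> by (cases xs) (auto simp: vs)
  qed (use dist p in auto)
qed

lemma card_core_arcs:
  assumes "distinct vs" "length vs \<noteq> 1"
  shows "card (core_arcs vs) = length vs"
  using assms by (subst core_arcs_conv_nth) (auto simp: card_image inj_on_def nth_eq_iff_index_eq)

text \<open>Rotating the vertices merely rotates the list of arcs.\<close>

lemma core_arcs_rotate: "core_arcs (rotate i vs) = core_arcs vs"
proof (induction i)
  case (Suc i)
  have "zip (y # ys @ [x]) (ys @ [x, y]) = zip (y # ys) (ys @ [x]) @ [(x, y)]" for x y :: 'a and ys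
    using zip_append[of "y # ys" "ys @ [x]" "[x]" "[y]"] by simp
  then have "zip (rotate1 ws) (rotate1 (rotate1 ws)) = rotate1 (zip ws (rotate1 ws))" for ws :: "'a list"
    by (cases ws; cases "tl ws") auto
  then have "core_arcs (rotate1 ws) = core_arcs ws" for ws :: "'a list"
    by (simp add: core_arcs_def)
  with Suc show ?case by simp
qed simp

text \<open>On a circuit every vertex has a unique successor. Hence the index \<open>i\<close> at
  which \<open>ws\<close> meets the first vertex of \<open>vs\<close> fixes all further entries, by
  induction along the circuit.\<close>

lemma core_arcs_eq_imp_rotate:
  assumes "distinct vs" "distinct ws" "length vs = length ws" "length ws \<ge> 2" "core_arcs vs = core_arcs ws"
  obtains i where "i < length ws" "vs = rotate i ws"
proof -
  let ?k = "length ws"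
  have ca: "core_arcs vs = (\<lambda>i. (vs ! i, vs ! (Suc i mod ?k))) ` {..<?k}"
    "core_arcs ws = (\<lambda>i. (ws ! i, ws ! (Suc i mod ?k))) ` {..<?k}"
    using assms by (simp_all add: core_arcs_conv_nth)
  have next_eq: "vs ! (Suc j mod ?k) = ws ! (Suc l mod ?k)" if "j < ?k" "l < ?k" "vs ! j = ws ! l" for j l
  proof -
    have "(vs ! j, vs ! (Suc j mod ?k)) \<in> core_arcs ws"
      using that(1) assms(5) ca(1) by auto
    then obtain l' where "l' < ?k" "vs ! j = ws ! l'" "vs ! (Suc j mod ?k) = ws ! (Suc l' mod ?k)"
      using ca(2) by auto
    with that assms(2) show ?thesis by (simp add: nth_eq_iff_index_eq)
  qed
  have "(vs ! 0, vs ! (Suc 0 mod ?k)) \<in> core_arcs ws"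
    using assms(4,5) ca(1) by force
  then obtain i where i: "i < ?k" "vs ! 0 = ws ! i"
    using ca(2) by auto
  have "vs ! j = ws ! ((i + j) mod ?k)" if "j < ?k" for j
    using that
  proof (induction j)
    case 0
    then show ?case using i by simp
  next
    case (Suc j)
    then have "(i + j) mod ?k < ?k" by (intro mod_less_divisor) auto
    with Suc next_eq[of j "(i + j) mod ?k"] show ?case
      by (auto simp: mod_Suc_eq)
  qed
  then have "vs = rotate i ws"
    using assms(3) by (intro nth_equalityI) (auto simp: nth_rotate)
  with i show thesis by (intro that)
qed

lemma card_core_arcs_rotations:
  assumes "distinct ws" "length ws \<ge> 2"
  shows "card {vs. distinct vs \<and> length vs = length ws \<and> core_arcs vs = core_arcs ws} = length ws"
proof -
  have "inj_on (\<lambda>i. rotate i ws) {..<length ws}"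
  proof (rule inj_onI)
    fix i j assume ij: "i \<in> {..<length ws}" "j \<in> {..<length ws}" "rotate i ws = rotate j ws"
    then have "rotate i ws ! 0 = rotate j ws ! 0" by simp
    with ij assms show "i = j"
      by (subst (asm) (1 2) nth_rotate) (auto simp: nth_eq_iff_index_eq)
  qed
  moreover have "{vs. distinct vs \<and> length vs = length ws \<and> core_arcs vs = core_arcs ws}
     = (\<lambda>i. rotate i ws) ` {..<length ws}" (is "?L = ?R")
  proof
    show "?L \<subseteq> ?R"
    proof
      fix vs assume "vs \<in> ?L"
      then obtain i where "i < length ws" "vs = rotate i ws"
        using core_arcs_eq_imp_rotate[of vs ws] assms by blast
      then show "vs \<in> ?R" by blast
    qed
    show "?R \<subseteq> ?L"
      using assms by (auto simp: core_arcs_rotate)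
  qed
  ultimately show ?thesis by (simp add: card_image)
qed

section \<open>Digraphs built from a core, a forest and orientations\<close>

text \<open>\<open>b q\<close> tells whether the tree edge between \<open>q\<close> and its parent \<open>f q\<close> is directed towards the parent.\<close>

definition tree_arc :: "('a \<Rightarrow> 'a) \<Rightarrow> ('a \<Rightarrow> bool) \<Rightarrow> 'a \<Rightarrow> 'a \<times> 'a" where
  "tree_arc f b q = (if b q then (q, f q) else (f q, q))"

definition core_graph :: "'a set \<Rightarrow> 'a list \<Rightarrow> ('a \<Rightarrow> 'a) \<Rightarrow> ('a \<Rightarrow> bool) \<Rightarrow> 'a pair_pre_digraph" where
  "core_graph V vs f b = \<lparr>pverts = V, parcs = core_arcs vs \<union> tree_arc f b ` (V - set vs)\<rparr>"

lemma core_graph_sel [simp]: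
  "pverts (core_graph V vs f b) = V"
  "parcs (core_graph V vs f b) = core_arcs vs \<union> tree_arc f b ` (V - set vs)"
  by (simp_all add: core_graph_def)

text \<open>An arc determines its two ends but not which of them is the child. Where it is applied,
  the exchanged case is excluded by comparing ranks.\<close>

lemma tree_arc_eq_cases:
  assumes "tree_arc f b q = tree_arc f' b' q'"
  obtains "q = q'" | "f q = q'" "f' q' = q"
proof -
  have "q = q' \<or> (f q = q' \<and> f' q' = q)"
    using assms unfolding tree_arc_def by (cases "b q"; cases "b' q'") simp_all
  then show thesis using that by blast
qed

lemma tree_arc_inj_on:
  assumes "f \<in> forests V R"
  shows "inj_on (tree_arc f b) (V - R)"
proof (rule inj_onI)
  fix q q' assume q: "q \<in> V - R" "q' \<in> V - R" and eq: "tree_arc f b q = tree_arc f b q'"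
  obtain d :: "'a \<Rightarrow> nat" where d: "\<forall>q \<in> V - R. d (f q) < d q"
    using assms by (rule forestsE) (rule that)
  from eq show "q = q'"
  proof (cases rule: tree_arc_eq_cases)
    case 2
    with q d have "d q' < d q" "d q < d q'" by force+
    then show ?thesis by simp
  qed
qed

lemma digraph_core_graph:
  assumes "finite V" "distinct vs" "set vs \<subseteq> V" "f \<in> forests V (set vs)"
  shows "digraph (with_proj (core_graph V vs f b))"
proof -
  obtain d :: "'a \<Rightarrow> nat" where d: "\<forall>q \<in> V - set vs. d (f q) < d q" and f: "\<And>q. q \<in> V - set vs \<Longrightarrow> f q \<in> V"
    using assms(4) by (rule forestsE) (rule that)
  have "f q \<noteq> q" "q \<noteq> f q" if "q \<in> V - set vs" for q
    using bspec[OF d that] by auto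
  then have "\<forall>e\<in>tree_arc f b ` (V - set vs). fst e \<noteq> snd e"
    by (auto simp: tree_arc_def)
  moreover have "tree_arc f b ` (V - set vs) \<subseteq> V \<times> V"
    using f by (auto simp: tree_arc_def split: if_splits)
  moreover have "core_arcs vs \<subseteq> V \<times> V"
    by (rule order_trans[OF core_arcs_subset Sigma_mono[OF assms(3) assms(3)]])
  moreover have "\<forall>e\<in>core_arcs vs. fst e \<noteq> snd e"
    using core_arcs_loopfree[OF assms(2)] by blast
  ultimately show ?thesis
    unfolding digraph_with_proj_iff core_graph_sel ball_Un using assms(1) by simp
qed

text \<open>Parents lead from any vertex to the core by induction on the rank; inside the core the
  circuit is followed backwards to its first vertex.\<close>

lemma core_graph_reach:
  assumes "vs \<noteq> []" "set vs \<subseteq> V" "f \<in> forests V (set vs)" "v \<in> V"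
  shows "(v, vs ! 0) \<in> (parcs (core_graph V vs f b) \<union> (parcs (core_graph V vs f b))\<inverse>)\<^sup>*"
    (is "_ \<in> ?S\<^sup>*")
proof -
  obtain d :: "'a \<Rightarrow> nat" where d: "\<forall>q \<in> V - set vs. d (f q) < d q" and f: "\<And>q. q \<in> V - set vs \<Longrightarrow> f q \<in> V"
    using assms(3) by (rule forestsE) (rule that)
  have core: "(vs ! i, vs ! 0) \<in> ?S\<^sup>*" if "i < length vs" for i
    using that
  proof (induction i)
    case (Suc i)
    then have "(vs ! i, vs ! Suc i) \<in> core_arcs vs"
      by (subst core_arcs_conv_nth) force+
    then have "(vs ! Suc i, vs ! i) \<in> ?S" by auto
    with Suc show ?case by (meson Suc_lessD converse_rtrancl_into_rtrancl)
  qed simp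
  show ?thesis
    using assms(4)
  proof (induction "d v" arbitrary: v rule: less_induct)
    case less
    show ?case
    proof (cases "v \<in> set vs")
      case True
      then show ?thesis using core by (metis in_set_conv_nth)
    next
      case False
      with less.prems have v: "v \<in> V - set vs" by simp
      then have "(v, f v) \<in> ?S"
        by (force simp: tree_arc_def)
      moreover have "(f v, vs ! 0) \<in> ?S\<^sup>*"
        using v d f by (intro less.hyps) auto
      ultimately show ?thesis by (rule converse_rtrancl_into_rtrancl)
    qed
  qed
qed

lemma connected_core_graph:
  assumes "finite V" "distinct vs" "vs \<noteq> []" "set vs \<subseteq> V" "f \<in> forests V (set vs)"
  shows "connected (with_proj (core_graph V vs f b))"
proof -
  let ?S = "parcs (core_graph V vs f b) \<union> (parcs (core_graph V vs f b))\<inverse>"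
  have sub: "parcs (core_graph V vs f b) \<subseteq> pverts (core_graph V vs f b) \<times> pverts (core_graph V vs f b)"
    using digraph_core_graph[OF assms(1,2,4,5), of b] by (auto simp: digraph_with_proj_iff)
  have "sym (?S\<^sup>*)"
    by (intro sym_rtrancl sym_Un_converse)
  then have "(u, v) \<in> ?S\<^sup>*" if "u \<in> V" "v \<in> V" for u v
    using core_graph_reach[OF assms(3-5)] that by (meson rtrancl_trans symD)
  then show ?thesis
    unfolding connected_with_proj_iff[OF sub] using assms(3,4) by auto
qed

text \<open>
  A vertex of largest rank on an undirected cycle is incident with only one arc of the cycle unless
  it belongs to the core, so that the whole cycle lies in the core.
\<close>

lemma undirected_cycle_core_graph:
  assumes "finite V" "distinct vs" "set vs \<subseteq> V" "f \<in> forests V (set vs)"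
    and cyc: "undirected_cycle (with_proj (core_graph V vs f b)) ws es"
  shows "length vs \<noteq> 1" "set es = core_arcs vs"
proof -
  let ?G = "core_graph V vs f b" and ?k = "length vs"
  obtain d :: "'a \<Rightarrow> nat" where d: "\<forall>q \<in> V - set vs. d (f q) < d q"
    using assms(4) by (rule forestsE) (rule that)
  have loopfree: "\<forall>e\<in>parcs ?G. fst e \<noteq> snd e"
    using digraph_core_graph[OF assms(1-4), of b] unfolding digraph_with_proj_iff by blast
  have es: "es \<noteq> []" "set es \<subseteq> parcs ?G" "length ws = length es"
    using cyc by (auto simp: undirected_cycle_with_proj)
  have "set ws \<subseteq> set vs"
  proof (rule ccontr)
    assume "\<not> set ws \<subseteq> set vs"
    then have "finite (set ws - set vs)" "set ws - set vs \<noteq> {}" by auto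
    then have "Max (d ` (set ws - set vs)) \<in> d ` (set ws - set vs)"
      by (intro Max_in) auto
    then obtain w where w: "w \<in> set ws - set vs" and "d w = Max (d ` (set ws - set vs))"
      by force
    then have wmax: "d x \<le> d w" if "x \<in> set ws - set vs" for x
      using that by simp
    have *: "e = tree_arc f b w" if e: "e \<in> set es" "w \<in> {fst e, snd e}" for e
    proof -
      have "e \<notin> core_arcs vs"
        using e(2) w core_arcs_subset[of vs] by auto
      with e(1) es(2) obtain q where q: "q \<in> V - set vs" "e = tree_arc f b q" by auto
      have "q \<in> set ws"
        using undirected_cycle_ends[OF cyc e(1)] q by (auto simp: tree_arc_def split: if_splits)
      then have "d q \<le> d w" using wmax q by auto
      moreover have "w = q \<or> w = f q"
        using e(2) q by (auto simp: tree_arc_def split: if_splits)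
      ultimately show ?thesis using q d by force
    qed
    obtain e e' where "e \<in> set es" "e' \<in> set es" "e \<noteq> e'" "w \<in> {fst e, snd e}" "w \<in> {fst e', snd e'}"
      using undirected_cycle_incident[OF cyc loopfree] w by blast
    then show False using * by metis
  qed
  have sub: "set es \<subseteq> core_arcs vs"
  proof
    fix e assume e: "e \<in> set es"
    then have "e \<in> core_arcs vs \<or> e \<in> tree_arc f b ` (V - set vs)"
      using es(2) by auto
    moreover have "fst e \<in> set vs" "snd e \<in> set vs"
      using undirected_cycle_ends[OF cyc e] \<open>set ws \<subseteq> set vs\<close> by auto
    ultimately show "e \<in> core_arcs vs"
      by (auto simp: tree_arc_def split: if_splits)
  qed
  with es(1) show k1: "?k \<noteq> 1"
    by (auto simp: core_arcs_def)
  define arc where "arc i = (vs ! i, vs ! (Suc i mod ?k))" for i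
  have core: "core_arcs vs = arc ` {..<?k}"
    using core_arcs_conv_nth[OF k1] by (simp add: arc_def)
  \<comment> \<open>A core vertex lies on only two core arcs, the outgoing and the incoming one. The
    cycle uses two distinct edges at this vertex, hence also the outgoing arc.\<close>
  have on_cycle: "arc i \<in> set es" if i: "i < ?k" "vs ! i \<in> set ws" for i
  proof -
    obtain e e' where e: "e \<in> set es" "e' \<in> set es" "e \<noteq> e'" "vs ! i \<in> {fst e, snd e}" "vs ! i \<in> {fst e', snd e'}"
      using undirected_cycle_incident[OF cyc loopfree i(2)] by blast
    have *: "x = arc i \<or> x = arc (if i = 0 then ?k - 1 else i - 1)"
      if x: "x \<in> set es" "vs ! i \<in> {fst x, snd x}" for x
    proof -
      obtain j where j: "j < ?k" "x = arc j" using x(1) sub core by auto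
      have "Suc j mod ?k < ?k" using j by (intro mod_less_divisor) auto
      with x(2) j i(1) assms(2) have "i = j \<or> i = Suc j mod ?k"
        by (auto simp: arc_def nth_eq_iff_index_eq)
      then have "i = j \<or> j = (if i = 0 then ?k - 1 else i - 1)"
        using j(1) by (auto simp: mod_Suc split: if_splits)
      then show ?thesis using j(2) by blast
    qed
    from *[of e] *[of e'] e show ?thesis by metis
  qed
  have "ws \<noteq> []" using es by auto
  then obtain x where x: "x \<in> set ws" by (cases ws) auto
  with \<open>set ws \<subseteq> set vs\<close> obtain i0 where i0: "i0 < ?k" "vs ! i0 \<in> set ws"
    by (metis in_set_conv_nth subsetD)
  \<comment> \<open>The outgoing arcs carry the cycle from one core vertex to the next, so it passes
    through the whole circuit.\<close>
  have around: "vs ! ((i0 + m) mod ?k) \<in> set ws" for m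
  proof (induction m)
    case 0
    then show ?case using i0 by simp
  next
    case (Suc m)
    have "(i0 + m) mod ?k < ?k" using i0 by (intro mod_less_divisor) auto
    then have "arc ((i0 + m) mod ?k) \<in> set es"
      using on_cycle Suc by blast
    from undirected_cycle_ends(2)[OF cyc this] show ?case
      by (simp add: arc_def mod_Suc_eq)
  qed
  have "arc i \<in> set es" if i: "i < ?k" for i
  proof -
    have "(i0 + (?k - i0 + i)) mod ?k = i" using i i0 by simp
    then show ?thesis using around[of "?k - i0 + i"] on_cycle[OF i] by simp
  qed
  with sub core show "set es = core_arcs vs" by auto
qed

lemma undirected_cycles_core_graph:
  assumes "finite V" "distinct vs" "vs \<noteq> []" "set vs \<subseteq> V" "f \<in> forests V (set vs)"
  shows "undirected_cycles (with_proj (core_graph V vs f b)) = (if length vs = 1 then {} else {core_arcs vs})"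
proof (cases "length vs = 1")
  case True
  with undirected_cycle_core_graph(1)[OF assms(1,2,4,5)] show ?thesis
    by (auto simp: undirected_cycles_def)
next
  case False
  let ?es = "zip vs (rotate1 vs)"
  have es: "set ?es = core_arcs vs"
    using False by (simp add: core_arcs_def)
  have "undirected_cycle (with_proj (core_graph V vs f b)) vs ?es"
    unfolding undirected_cycle_with_proj es
    using assms by (auto simp: distinct_zipI1 nth_rotate1)
  then have "core_arcs vs \<in> undirected_cycles (with_proj (core_graph V vs f b))"
    unfolding undirected_cycles_def using es by auto
  moreover have "X = core_arcs vs" if "X \<in> undirected_cycles (with_proj (core_graph V vs f b))" for X
    using that undirected_cycle_core_graph(2)[OF assms(1,2,4,5)] by (auto simp: undirected_cycles_def)
  ultimately show ?thesis
    unfolding if_not_P[OF False] by blast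
qed

lemma unicircuit_core_graph:
  assumes "finite V" "distinct vs" "vs \<noteq> []" "set vs \<subseteq> V" "f \<in> forests V (set vs)"
  shows "unicircuit (with_proj (core_graph V vs f b))"
proof -
  have "core_arcs vs \<in> directed_circuits (with_proj (core_graph V vs f b))" if "length vs \<noteq> 1"
  proof (rule core_arcs_directed_circuit)
    show "length vs \<ge> 2"
      using that assms(3) by (cases vs) (auto simp: Suc_le_eq)
  qed (use assms in simp_all)
  then show ?thesis
    unfolding unicircuit_def undirected_cycles_core_graph[OF assms]
    using digraph_core_graph[OF assms(1,2,4,5)] connected_core_graph[OF assms] by simp
qed

text \<open>By induction on the rank for \<open>f\<close>, the arc of \<open>q\<close> must be the
  tree arc of some \<open>q'\<close> for \<open>f'\<close>. If \<open>q'\<close> differs from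
  \<open>q\<close>, then \<open>q'\<close> is the parent \<open>f q\<close>, of smaller rank, so
  \<open>f q' = f' q' = q\<close>; this contradicts the ranks.\<close>

lemma core_graph_inj:
  assumes "f \<in> forests V (set vs)" "f' \<in> forests V (set vs)"
    "b \<in> (V - set vs) \<rightarrow>\<^sub>E UNIV" "b' \<in> (V - set vs) \<rightarrow>\<^sub>E UNIV"
    and eq: "core_graph V vs f b = core_graph V vs f' b'"
  shows "f = f'" "b = b'"
proof -
  obtain d :: "'a \<Rightarrow> nat" where d: "\<forall>q \<in> V - set vs. d (f q) < d q" 
    using assms(1) by (rule forestsE) (rule that)
  have f: "f \<in> (V - set vs) \<rightarrow>\<^sub>E V" and f': "f' \<in> (V - set vs) \<rightarrow>\<^sub>E V"
    using assms(1,2) by (simp_all add: forests_def)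
  have same: "tree_arc f b q = tree_arc f' b' q \<and> f q = f' q" if "q \<in> V - set vs" for q
    using that
  proof (induction "d q" arbitrary: q rule: less_induct)
    case less
    have "tree_arc f b q \<in> parcs (core_graph V vs f' b')"
      unfolding eq[symmetric] using less.prems by simp
    moreover have "tree_arc f b q \<notin> core_arcs vs"
      using less.prems core_arcs_subset[of vs] by (auto simp: tree_arc_def)
    ultimately obtain q' where q': "q' \<in> V - set vs" "tree_arc f b q = tree_arc f' b' q'" by auto
    have "q = q'"
      using q'(2)
    proof (cases rule: tree_arc_eq_cases)
      case 2
      have "d q' < d q" using 2 d less.prems by auto
      with less.hyps q'(1) have "f q' = f' q'" by auto
      with 2 d q'(1) have "d q < d q'" by force
      with \<open>d q' < d q\<close> show ?thesis by simp
    qed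
    moreover have "f q \<noteq> q" using d less.prems by force
    ultimately show ?case using q'(2) by (auto simp: tree_arc_def split: if_splits)
  qed
  show "f = f'"
    using f f' same by (intro PiE_ext) auto
  have "b q = b' q" if "q \<in> V - set vs" for q
  proof -
    have "f q \<noteq> q" using d that by force
    with same[OF that] show ?thesis by (auto simp: tree_arc_def split: if_splits)
  qed
  with assms(3,4) show "b = b'" by (intro PiE_ext) auto
qed

section \<open>Every unicircuit digraph arises from each of its cores\<close>

text \<open>Every vertex off the core gets as parent a neighbour closer to the core. The resulting
  core graph is connected, so any further arc of \<open>D\<close> would close an undirected cycle
  that is not the core, which is impossible in a unicircuit digraph.\<close>

lemma core_graph_exists:
  assumes uni: "unicircuit (with_proj D)" and vs: "vs \<noteq> []" "distinct vs" "set vs \<subseteq> pverts D"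
    and cycles: "if length vs = 1 then undirected_cycles (with_proj D) = {}
      else core_arcs vs \<in> undirected_cycles (with_proj D)"
  obtains f b where "f \<in> forests (pverts D) (set vs)" "b \<in> (pverts D - set vs) \<rightarrow>\<^sub>E UNIV"
    "D = core_graph (pverts D) vs f b"
proof -
  let ?V = "pverts D" and ?A = "parcs D" and ?R = "set vs"
  let ?S = "?A \<union> ?A\<inverse>"
  have D: "finite ?V" "?A \<subseteq> ?V \<times> ?V" "\<forall>e\<in>?A. fst e \<noteq> snd e"
    using uni unfolding unicircuit_def digraph_with_proj_iff by auto
  have reach: "(u, v) \<in> ?S\<^sup>*" if "u \<in> ?V" "v \<in> ?V" for u v
    using uni that unfolding unicircuit_def connected_with_proj_iff[OF D(2)] by auto
  have core_sub: "core_arcs vs \<subseteq> ?A"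
    using cycles by (auto simp: core_arcs_def undirected_cycles_def undirected_cycle_with_proj split: if_splits)
  define P where "P v m \<longleftrightarrow> (\<exists>r\<in>?R. (v, r) \<in> ?S ^^ m)" for v m
  \<comment> \<open>The undirected distance to the core serves as rank function.\<close>
  define d where "d v = (LEAST m. P v m)" for v
  have "\<exists>m. P v m" if "v \<in> ?V" for v
    using reach[OF that, of "vs ! 0"] vs unfolding P_def rtrancl_power
    by (metis length_greater_0_conv nth_mem subsetD)
  then have Pd: "P v (d v)" if "v \<in> ?V" for v
    unfolding d_def using that by (metis LeastI)
  have "\<exists>y. (q, y) \<in> ?S \<and> d y < d q" if q: "q \<in> ?V - ?R" for q
  proof -
    have "\<not> P q 0" "P q (d q)"
      using Pd[of q] q by (auto simp: P_def)
    then have "d q \<noteq> 0" by metis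
    then obtain m where m: "d q = Suc m" by (cases "d q") auto
    obtain r where r: "r \<in> ?R" "(q, r) \<in> ?S ^^ Suc m"
      using Pd[of q] q m by (auto simp: P_def)
    then obtain y where y: "(q, y) \<in> ?S" "(y, r) \<in> ?S ^^ m"
      by (metis relpow_Suc_D2)
    then have "P y m" using r by (auto simp: P_def)
    then have "d y \<le> m" unfolding d_def by (rule Least_le)
    with y m show ?thesis by auto
  qed
  then obtain g where g: "\<And>q. q \<in> ?V - ?R \<Longrightarrow> (q, g q) \<in> ?S \<and> d (g q) < d q"
    by metis
  define f where "f = restrict g (?V - ?R)"
  \<comment> \<open>If both arcs between \<open>q\<close> and \<open>g q\<close> were present, the
    one towards the parent would be chosen; the argument with closing arcs below also excludes the
    other.\<close>
  define b where "b = restrict (\<lambda>q. (q, g q) \<in> ?A) (?V - ?R)"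
  have f: "f \<in> forests ?V ?R"
    unfolding forests_def
    by (intro CollectI conjI exI[of _ d]) (use g D(2) in \<open>fastforce simp: f_def\<close>)+
  have b: "b \<in> (?V - ?R) \<rightarrow>\<^sub>E UNIV" by (simp add: b_def)
  let ?G = "core_graph ?V vs f b"
  have sub: "parcs ?G \<subseteq> ?A"
    using core_sub g by (auto simp: tree_arc_def f_def b_def)
  have Gsub: "parcs ?G \<subseteq> pverts ?G \<times> pverts ?G"
    using sub D(2) by auto
  have "?A \<subseteq> parcs ?G"
  proof (rule ccontr)
    assume "\<not> ?A \<subseteq> parcs ?G"
    then obtain x y where xy: "(x, y) \<in> ?A - parcs ?G" by auto
    then have V: "x \<in> ?V" "y \<in> ?V" "x \<noteq> y" using D by auto
    have "(y, x) \<in> (parcs ?G \<union> (parcs ?G)\<inverse>)\<^sup>*"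
      using connected_core_graph[OF D(1) vs(2,1,3) f, of b] V
      unfolding connected_with_proj_iff[OF Gsub] by simp
    then obtain X where X: "X \<in> undirected_cycles (with_proj D)" "(x, y) \<in> X"
      using undirected_cycle_closing_arc[OF sub xy V(3)] by blast
    have "X = core_arcs vs"
      using X(1) cycles uni unfolding unicircuit_def by (auto split: if_splits)
    with X(2) xy show False by simp
  qed
  with sub have "D = ?G" by (intro pair_pre_digraph.equality) auto
  with f b that show thesis by blast
qed

subsection \<open>Well-colourings as signed markings\<close>

text \<open>
  Inclusion-exclusion: the factor \<open>1 - [no red child]\<close> of a green vertex is split into the marks
  \<open>Free\<close>, contributing \<open>1\<close>, and \<open>Barred\<close>, contributing \<open>- [no red child]\<close>.
\<close>

datatype mark = Rd | Barred | Free

lemma UNIV_mark: "UNIV = {Rd, Barred, Free}"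
  using mark.exhaust by auto

instance mark :: finite
  by standard (simp add: UNIV_mark)

definition mark_sign :: "mark \<Rightarrow> real" where
  "mark_sign x = (if x = Barred then -1 else 1)"

definition arc_weight :: "mark \<Rightarrow> mark \<Rightarrow> real" where
  "arc_weight x y = (if x \<noteq> Free \<and> y = Rd then 0 else 1)"

definition mark_colour :: "mark \<Rightarrow> colour" where
  "mark_colour x = (if x = Rd then Red else Green)"

lemma UNIV_colour: "UNIV = {Red, Green}"
  using colour.exhaust by auto

lemma prod_of_bool:
  "finite S \<Longrightarrow> (\<Prod>e\<in>S. of_bool (P e)) = (of_bool (\<forall>e\<in>S. P e) :: 'c :: comm_semiring_1)"
  by (induction S rule: finite_induct) auto

lemma ext_undefined: "ext (\<lambda>_. undefined) V = V \<rightarrow>\<^sub>E UNIV"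
  by (auto simp: ext_def PiE_def extensional_def)

lemma finite_well_colourings:
  assumes "finite (pverts D)"
  shows "finite {c. well_colouring (with_proj D) c}"
  by (rule finite_subset[of _ "pverts D \<rightarrow>\<^sub>E UNIV"])
     (use assms in \<open>auto simp: well_colouring_def UNIV_colour finite_PiE\<close>)

text \<open>For a fixed colouring, the indicator of being a well-colouring is a product of local
  factors, each of which is a sum over the marks of the given colour. Expanding the product leaves a
  sum over all markings.\<close>

lemma card_well_colourings:
  assumes "finite (pverts D)" "parcs D \<subseteq> pverts D \<times> pverts D"
  shows "real (card {c. well_colouring (with_proj D) c}) =
    (\<Sum>t\<in>ext (\<lambda>_. undefined) (pverts D).
       (\<Prod>v\<in>pverts D. mark_sign (t v)) * (\<Prod>e\<in>parcs D. arc_weight (t (fst e)) (t (snd e))))"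
proof -
  let ?V = "pverts D" and ?A = "parcs D"
  have finA: "finite ?A"
    using assms by (meson finite_SigmaI finite_subset)
  \<comment> \<open>This indicator of having no red child is written as a product over the outgoing
    arcs, so that in the end all vertices together yield one product over
    \<open>parcs D\<close>.\<close>
  define n :: "('a \<Rightarrow> colour) \<Rightarrow> 'a \<Rightarrow> real" where
    "n c u = (\<Prod>e\<in>{e\<in>?A. fst e = u}. of_bool (c (snd e) \<noteq> Red))" for c u
  define g where "g c u x = (if x = Free then 1 else mark_sign x * n c u)" for c u x
  have n_eq: "n c u = of_bool (\<forall>v. (u, v) \<in> ?A \<longrightarrow> c v \<noteq> Red)" for c u
    unfolding n_def using finA by (subst prod_of_bool) (auto intro!: arg_cong[where f = of_bool])
  have g_sum: "(\<Sum>x | mark_colour x = y. g c u x) = (if y = Red then n c u else 1 - n c u)" for c u y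
  proof -
    have "{x. mark_colour x = y} = (if y = Red then {Rd} else {Barred, Free})"
      using UNIV_mark colour.exhaust by (auto simp: mark_colour_def)
    then show ?thesis by (simp add: g_def mark_sign_def)
  qed
  have "real (card {c. well_colouring (with_proj D) c}) = (\<Sum>c\<in>{c\<in>?V \<rightarrow>\<^sub>E UNIV. well_colouring (with_proj D) c}. 1)"
    by (simp add: well_colouring_def)
  also have "\<dots> = (\<Sum>c\<in>?V \<rightarrow>\<^sub>E UNIV. of_bool (well_colouring (with_proj D) c))"
    using assms by (intro sum.mono_neutral_cong_left) (auto simp: finite_PiE UNIV_colour)
  also have "\<dots> = (\<Sum>c\<in>?V \<rightarrow>\<^sub>E UNIV. \<Prod>u\<in>?V. \<Sum>x | mark_colour x = c u. g c u x)"
  proof (intro sum.cong refl)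
    fix c :: "'a \<Rightarrow> colour" assume c: "c \<in> ?V \<rightarrow>\<^sub>E UNIV"
    have "(\<Sum>x | mark_colour x = c u. g c u x) =
      of_bool ((c u = Green \<longrightarrow> (\<exists>v. (u, v) \<in> ?A \<and> c v = Red)) \<and> (c u = Red \<longrightarrow> \<not> (\<exists>v. (u, v) \<in> ?A \<and> c v = Red)))" for u
      unfolding g_sum n_eq by (cases "c u") auto
    then show "of_bool (well_colouring (with_proj D) c) = (\<Prod>u\<in>?V. \<Sum>x | mark_colour x = c u. g c u x)"
      using c assms by (simp add: prod_of_bool well_colouring_def ball_conj_distrib)
  qed
  also have "\<dots> = (\<Sum>c\<in>?V \<rightarrow>\<^sub>E UNIV. \<Sum>t\<in>(\<Pi>\<^sub>E u\<in>?V. {x. mark_colour x = c u}). \<Prod>u\<in>?V. g c u (t u))"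
    using assms by (intro sum.cong refl prod_sum_PiE) auto
  also have "\<dots> = (\<Sum>(c, t)\<in>Sigma (?V \<rightarrow>\<^sub>E UNIV) (\<lambda>c. \<Pi>\<^sub>E u\<in>?V. {x. mark_colour x = c u}). \<Prod>u\<in>?V. g c u (t u))"
    using assms by (intro sum.Sigma) (auto simp: finite_PiE UNIV_colour)
  \<comment> \<open>The marks determine the colours, hence the double sum collapses.\<close>
  also have "\<dots> = (\<Sum>t\<in>?V \<rightarrow>\<^sub>E UNIV. \<Prod>u\<in>?V. g (restrict (mark_colour \<circ> t) ?V) u (t u))"
  proof (rule sum.reindex_bij_witness[where i = "\<lambda>t. (restrict (mark_colour \<circ> t) ?V, t)" and j = snd])
    fix a assume "a \<in> Sigma (?V \<rightarrow>\<^sub>E UNIV) (\<lambda>c. \<Pi>\<^sub>E u\<in>?V. {x. mark_colour x = c u})"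
    then obtain c t where a: "a = (c, t)" "c \<in> ?V \<rightarrow>\<^sub>E UNIV" "t \<in> (\<Pi>\<^sub>E u\<in>?V. {x. mark_colour x = c u})"
      by auto
    have "restrict (mark_colour \<circ> t) ?V = c"
    proof
      fix v show "restrict (mark_colour \<circ> t) ?V v = c v"
        using a by (cases "v \<in> ?V") (auto simp: PiE_iff extensional_def)
    qed
    then show "(restrict (mark_colour \<circ> snd a) ?V, snd a) = a"
      "(\<Prod>u\<in>?V. g (restrict (mark_colour \<circ> snd a) ?V) u (snd a u)) = (case a of (c, t) \<Rightarrow> \<Prod>u\<in>?V. g c u (t u))"
      by (simp_all add: a)
    show "snd a \<in> ?V \<rightarrow>\<^sub>E UNIV" using a by (auto simp: PiE_iff)
  qed (auto simp: PiE_iff)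
  also have "\<dots> = (\<Sum>t\<in>?V \<rightarrow>\<^sub>E UNIV. (\<Prod>v\<in>?V. mark_sign (t v)) * (\<Prod>e\<in>?A. arc_weight (t (fst e)) (t (snd e))))"
  proof (intro sum.cong refl)
    fix t :: "'a \<Rightarrow> mark"
    let ?c = "restrict (mark_colour \<circ> t) ?V"
    have "g ?c u (t u) = mark_sign (t u) * (\<Prod>e\<in>{e\<in>?A. fst e = u}. arc_weight (t (fst e)) (t (snd e)))" for u
    proof -
      have "n ?c u = (\<Prod>e\<in>{e\<in>?A. fst e = u}. of_bool (t (snd e) \<noteq> Rd))"
        unfolding n_def using assms(2) by (intro prod.cong) (auto simp: mark_colour_def)
      then show ?thesis
        by (auto simp: g_def mark_sign_def arc_weight_def intro!: prod.cong)
    qed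
    moreover have "(\<Prod>u\<in>?V. \<Prod>e\<in>{e\<in>?A. fst e = u}. arc_weight (t (fst e)) (t (snd e)))
      = (\<Prod>e\<in>?A. arc_weight (t (fst e)) (t (snd e)))"
      using assms finA by (intro prod.group) auto
    ultimately show "(\<Prod>u\<in>?V. g ?c u (t u))
      = (\<Prod>v\<in>?V. mark_sign (t v)) * (\<Prod>e\<in>?A. arc_weight (t (fst e)) (t (snd e)))"
      by (simp add: prod.distrib)
  qed
  finally show ?thesis
    by (simp add: ext_undefined)
qed

section \<open>Summation over orientations, forests and marks\<close>

text \<open>The two summands belong to the two orientations of a tree edge from parent mark
  \<open>x\<close> to child mark \<open>y\<close>. The sign of the child is included, so each vertex
  off the core contributes its sign through its parent edge.\<close>

definition edge_weight :: "mark \<Rightarrow> mark \<Rightarrow> real" where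
  "edge_weight x y = mark_sign y * (arc_weight x y + arc_weight y x)"

text \<open>For fixed marks the tree edges are oriented independently, so the sum over
  \<open>b\<close> of a product is a product of two-term sums.\<close>

lemma sum_orientations_card_well_colourings:
  assumes "finite V" "distinct vs" "set vs \<subseteq> V" "f \<in> forests V (set vs)"
  shows "(\<Sum>b\<in>(V - set vs) \<rightarrow>\<^sub>E UNIV. real (card {c. well_colouring (with_proj (core_graph V vs f b)) c}))
    = (\<Sum>t\<in>ext (\<lambda>_. undefined) V. (\<Prod>v\<in>set vs. mark_sign (t v)) *
        (\<Prod>e\<in>core_arcs vs. arc_weight (t (fst e)) (t (snd e))) *
        (\<Prod>q\<in>V - set vs. edge_weight (t (f q)) (t q)))"
proof -
  let ?B = "V - set vs"
  have finB: "finite ?B" and finC: "finite (core_arcs vs)"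
    using assms(1) by (simp_all add: core_arcs_def)
  have dig: "digraph (with_proj (core_graph V vs f b))" for b
    by (rule digraph_core_graph[OF assms])
  define aw where "aw t \<beta> q = (if \<beta> then arc_weight (t q) (t (f q)) else arc_weight (t (f q)) (t q))"
    for t :: "'a \<Rightarrow> mark" and \<beta> q
  have arcs: "(\<Prod>e\<in>parcs (core_graph V vs f b). arc_weight (t (fst e)) (t (snd e)))
     = (\<Prod>e\<in>core_arcs vs. arc_weight (t (fst e)) (t (snd e))) * (\<Prod>q\<in>?B. aw t (b q) q)" for b t
  proof -
    have "e \<notin> core_arcs vs" if "e \<in> tree_arc f b ` ?B" for e
      using that core_arcs_subset[of vs] by (auto simp: tree_arc_def split: if_splits)
    then have "core_arcs vs \<inter> tree_arc f b ` ?B = {}" by blast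
    moreover have "(\<Prod>e\<in>tree_arc f b ` ?B. arc_weight (t (fst e)) (t (snd e))) = (\<Prod>q\<in>?B. aw t (b q) q)"
      by (subst prod.reindex[OF tree_arc_inj_on[OF assms(4)]]) (auto simp: aw_def tree_arc_def intro!: prod.cong)
    ultimately show ?thesis
      using finB finC by (simp add: prod.union_disjoint)
  qed
  have "(\<Sum>b\<in>?B \<rightarrow>\<^sub>E UNIV. real (card {c. well_colouring (with_proj (core_graph V vs f b)) c}))
    = (\<Sum>b\<in>?B \<rightarrow>\<^sub>E UNIV. \<Sum>t\<in>ext (\<lambda>_. undefined) V. (\<Prod>v\<in>V. mark_sign (t v)) *
        ((\<Prod>e\<in>core_arcs vs. arc_weight (t (fst e)) (t (snd e))) * (\<Prod>q\<in>?B. aw t (b q) q)))"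
    using dig unfolding digraph_with_proj_iff
    by (subst card_well_colourings) (simp_all only: arcs core_graph_sel(1))
  also have "\<dots> = (\<Sum>t\<in>ext (\<lambda>_. undefined) V. (\<Prod>v\<in>V. mark_sign (t v)) *
        ((\<Prod>e\<in>core_arcs vs. arc_weight (t (fst e)) (t (snd e))) * (\<Sum>b\<in>?B \<rightarrow>\<^sub>E UNIV. \<Prod>q\<in>?B. aw t (b q) q)))"
    by (subst sum.swap) (simp add: sum_distrib_left)
  also have "\<dots> = (\<Sum>t\<in>ext (\<lambda>_. undefined) V. (\<Prod>v\<in>set vs. mark_sign (t v)) *
        (\<Prod>e\<in>core_arcs vs. arc_weight (t (fst e)) (t (snd e))) *
        (\<Prod>q\<in>?B. edge_weight (t (f q)) (t q)))"
  proof (intro sum.cong refl)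
    fix t :: "'a \<Rightarrow> mark"
    have "(\<Sum>b\<in>?B \<rightarrow>\<^sub>E UNIV. \<Prod>q\<in>?B. aw t (b q) q) = (\<Prod>q\<in>?B. \<Sum>\<beta>\<in>UNIV. aw t \<beta> q)"
      by (rule prod_sum_PiE[symmetric]) (use finB in auto)
    also have "\<dots> = (\<Prod>q\<in>?B. arc_weight (t (f q)) (t q) + arc_weight (t q) (t (f q)))"
      by (simp add: UNIV_bool aw_def)
    finally have "(\<Sum>b\<in>?B \<rightarrow>\<^sub>E UNIV. \<Prod>q\<in>?B. aw t (b q) q) = \<dots>" .
    moreover have "(\<Prod>v\<in>V. mark_sign (t v)) = (\<Prod>v\<in>?B. mark_sign (t v)) * (\<Prod>v\<in>set vs. mark_sign (t v))"
      by (rule prod.subset_diff[OF assms(3,1)])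
    ultimately show "(\<Prod>v\<in>V. mark_sign (t v)) *
        ((\<Prod>e\<in>core_arcs vs. arc_weight (t (fst e)) (t (snd e))) * (\<Sum>b\<in>?B \<rightarrow>\<^sub>E UNIV. \<Prod>q\<in>?B. aw t (b q) q))
      = (\<Prod>v\<in>set vs. mark_sign (t v)) * (\<Prod>e\<in>core_arcs vs. arc_weight (t (fst e)) (t (snd e))) *
        (\<Prod>q\<in>?B. edge_weight (t (f q)) (t q))"
      by (simp add: edge_weight_def prod.distrib mult_ac)
  qed
  finally show ?thesis .
qed

text \<open>
  \<open>X\<close> assigns to each mark the exponential generating function of the signed trees whose root has
  that mark.
\<close>

definition core_sum :: "(mark \<Rightarrow> real fps) \<Rightarrow> 'a list \<Rightarrow> real fps" where
  "core_sum X vs = (\<Sum>t\<in>ext (\<lambda>_. undefined) (set vs).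
     (\<Prod>e\<in>core_arcs vs. fps_const (arc_weight (t (fst e)) (t (snd e)))) * (\<Prod>p\<in>set vs. X (t p)))"

lemma sum_forests_card_well_colourings:
  fixes E X :: "mark \<Rightarrow> real fps"
  assumes E: "\<And>x. E x = fps_exp 1 oo (\<Sum>y\<in>UNIV. fps_const (edge_weight x y) * (fps_X * E y))"
    and X: "\<And>x. X x = fps_X * (fps_const (mark_sign x) * E x)"
    and V: "finite V" "distinct vs" "set vs \<subseteq> V"
  shows "(\<Sum>f\<in>forests V (set vs). \<Sum>b\<in>(V - set vs) \<rightarrow>\<^sub>E UNIV.
      real (card {c. well_colouring (with_proj (core_graph V vs f b)) c}))
    = fact (card V - length vs) * core_sum X vs $ card V"
proof -
  let ?B = "V - set vs" and ?t0 = "(\<lambda>_. undefined) :: 'a \<Rightarrow> mark" and ?m = "card V - length vs"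
  have k: "length vs \<le> card V"
    using V by (metis card_mono distinct_card)
  have un: "set vs \<union> ?B = V"
    using V by auto
  have m: "card ?B = ?m"
    using V by (simp add: card_Diff_subset distinct_card)
  define c where "c t = (\<Prod>v\<in>set vs. mark_sign (t v)) * (\<Prod>e\<in>core_arcs vs. arc_weight (t (fst e)) (t (snd e)))"
    for t :: "'a \<Rightarrow> mark"
  have c_cong: "c s = c t" if "s \<in> ext t ?B" for s t
  proof -
    have "s v = t v" if "v \<in> set vs" for v
      using \<open>s \<in> ext t ?B\<close> that by (auto simp: ext_def)
    then show ?thesis
      unfolding c_def using core_arcs_subset[of vs] by (intro arg_cong2[of _ _ _ _ "(*)"] prod.cong) auto
  qed
  have "(\<Sum>f\<in>forests V (set vs). \<Sum>b\<in>?B \<rightarrow>\<^sub>E UNIV.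
      real (card {c. well_colouring (with_proj (core_graph V vs f b)) c}))
    = (\<Sum>f\<in>forests V (set vs). \<Sum>t\<in>ext ?t0 (set vs \<union> ?B). c t * (\<Prod>q\<in>?B. edge_weight (t (f q)) (t q)))"
    unfolding un c_def by (intro sum.cong refl sum_orientations_card_well_colourings V)
  also have "\<dots> = (\<Sum>f\<in>forests V (set vs). \<Sum>t\<in>ext ?t0 (set vs). \<Sum>s\<in>ext t ?B.
      c t * (\<Prod>q\<in>?B. edge_weight (s (f q)) (s q)))"
    using V by (subst sum_ext_Un) (auto intro!: sum.cong dest: c_cong)
  also have "\<dots> = (\<Sum>t\<in>ext ?t0 (set vs). c t *
      (\<Sum>f\<in>forests V (set vs). \<Sum>s\<in>ext t ?B. \<Prod>q\<in>?B. edge_weight (s (f q)) (s q)))"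
    by (subst sum.swap) (simp add: sum_distrib_left)
  also have "\<dots> = (\<Sum>t\<in>ext ?t0 (set vs). c t * (fact ?m * (\<Prod>p\<in>set vs. E (t p)) $ ?m))"
    unfolding m[symmetric] by (simp only: forest_sum[OF E V(1,3)])
  \<comment> \<open>\<open>E\<close> does not count the root while \<open>X\<close> does; the core
    vertices supply the factor \<open>fps_X ^ length vs\<close>.\<close>
  also have "\<dots> = fact ?m * (\<Sum>t\<in>ext ?t0 (set vs). (fps_X ^ length vs * (fps_const (c t) * (\<Prod>p\<in>set vs. E (t p)))) $ card V)"
    using k by (simp add: fps_X_power_mult_nth sum_distrib_left mult_ac)
  also have "\<dots> = fact ?m * core_sum X vs $ card V"
  proof -
    have const_prod: "fps_const (\<Prod>e\<in>S. h e) = (\<Prod>e\<in>S. fps_const (h e))" for S and h :: "'b \<Rightarrow> real"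
      by (induction S rule: infinite_finite_induct) (auto simp flip: fps_const_mult)
    have "fps_X ^ length vs * (fps_const (c t) * (\<Prod>p\<in>set vs. E (t p)))
      = (\<Prod>e\<in>core_arcs vs. fps_const (arc_weight (t (fst e)) (t (snd e)))) * (\<Prod>p\<in>set vs. X (t p))" for t
      by (simp add: X c_def prod.distrib const_prod distinct_card[OF V(2)] mult_ac flip: fps_const_mult)
    then show ?thesis by (simp add: core_sum_def fps_sum_nth)
  qed
  finally show ?thesis .
qed

section \<open>The transfer matrix of a circuit\<close>

text \<open>The list \<open>us\<close> holds the inner vertices of a walk from mark \<open>x\<close>
  to mark \<open>y\<close>. The end contributes no factor \<open>X\<close>, so that a closed walk
  counts each vertex once.\<close>

fun walk_weight :: "(mark \<Rightarrow> real fps) \<Rightarrow> ('a \<Rightarrow> mark) \<Rightarrow> mark \<Rightarrow> 'a list \<Rightarrow> mark \<Rightarrow> real fps" where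
  "walk_weight X t x [] y = X x * fps_const (arc_weight x y)"
| "walk_weight X t x (u # us) y = X x * fps_const (arc_weight x (t u)) * walk_weight X t (t u) us y"

text \<open>With \<open>n\<close> inner vertices this is the entry \<open>(x, y)\<close> of the
  power \<open>n + 1\<close> of the transfer matrix.\<close>

fun walk_sum :: "(mark \<Rightarrow> real fps) \<Rightarrow> nat \<Rightarrow> mark \<Rightarrow> mark \<Rightarrow> real fps" where
  "walk_sum X 0 x y = X x * fps_const (arc_weight x y)"
| "walk_sum X (Suc n) x y = (\<Sum>z\<in>UNIV. X x * fps_const (arc_weight x z) * walk_sum X n z y)"

lemma sum_walk_weight:
  assumes "distinct us"
  shows "(\<Sum>t\<in>ext t0 (set us). walk_weight X t x us y) = walk_sum X (length us) x y"
  using assms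
proof (induction us arbitrary: t0 x)
  case Nil
  have "ext t0 {} = {t0}" by (auto simp: ext_def)
  then show ?case by simp
next
  case (Cons u us)
  have "(\<Sum>t\<in>ext t0 (set (u # us)). walk_weight X t x (u # us) y)
     = (\<Sum>s\<in>ext t0 {u}. \<Sum>t\<in>ext s (set us). X x * fps_const (arc_weight x (t u)) * walk_weight X t (t u) us y)"
    using Cons.prems sum_ext_Un[of "{u}" "set us" "\<lambda>t. X x * fps_const (arc_weight x (t u)) * walk_weight X t (t u) us y" t0]
    by simp
  also have "\<dots> = (\<Sum>s\<in>ext t0 {u}. \<Sum>t\<in>ext s (set us). X x * fps_const (arc_weight x (s u)) * walk_weight X t (s u) us y)"
    using Cons.prems by (intro sum.cong refl) (auto simp: ext_def)
  also have "\<dots> = (\<Sum>s\<in>ext t0 {u}. X x * fps_const (arc_weight x (s u)) * walk_sum X (length us) (s u) y)"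
    using Cons by (simp flip: sum_distrib_left)
  also have "\<dots> = (\<Sum>z\<in>UNIV. X x * fps_const (arc_weight x z) * walk_sum X (length us) z y)"
    using sum_prod_ext[of "{u}" "\<lambda>_ z. X x * fps_const (arc_weight x z) * walk_sum X (length us) z y" t0]
    by simp
  finally show ?case by simp
qed

lemma core_sum_single: "core_sum X [v] = (\<Sum>x\<in>UNIV. X x)"
  using sum_prod_ext[of "{v}" "\<lambda>_. X" "\<lambda>_. undefined"] by (simp add: core_sum_def core_arcs_def)

text \<open>The circuit is cut open at its first vertex \<open>v\<close>. Summing over the marks of
  the other \<open>n + 1\<close> vertices gives a diagonal entry, and the mark of \<open>v\<close>
  then gives the trace.\<close>

lemma core_sum_cycle:
  assumes "distinct vs" "length vs = Suc (Suc n)"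
  shows "core_sum X vs = (\<Sum>x\<in>UNIV. walk_sum X (Suc n) x x)"
proof -
  obtain v us where vs: "vs = v # us" and us: "length us = Suc n"
    using assms(2) by (cases vs) auto
  have prods: "(\<Prod>(p, q)\<leftarrow>zip (v # us) (us @ [y]). fps_const (arc_weight (t p) (t q))) * (\<Prod>p\<leftarrow>v # us. X (t p))
      = walk_weight X t (t v) us (t y)" for y t and v :: 'a and us
    by (induction us arbitrary: v) (auto simp: mult_ac)
  have term_eq: "(\<Prod>e\<in>core_arcs vs. fps_const (arc_weight (t (fst e)) (t (snd e)))) * (\<Prod>p\<in>set vs. X (t p))
      = walk_weight X t (t v) us (t v)" for t
  proof -
    have "core_arcs vs = set (zip (v # us) (us @ [v]))"
      using us by (auto simp: core_arcs_def vs)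
    moreover have "distinct (zip (v # us) (us @ [v]))"
      using assms(1) by (intro distinct_zipI1) (simp add: vs)
    ultimately have "(\<Prod>e\<in>core_arcs vs. fps_const (arc_weight (t (fst e)) (t (snd e))))
        = (\<Prod>(p, q)\<leftarrow>zip (v # us) (us @ [v]). fps_const (arc_weight (t p) (t q)))"
      by (simp only: prod.distinct_set_conv_list split_def)
    moreover have "(\<Prod>p\<in>set vs. X (t p)) = (\<Prod>p\<leftarrow>v # us. X (t p))"
      unfolding vs[symmetric] by (rule prod.distinct_set_conv_list[OF assms(1)])
    ultimately show ?thesis using prods by simp
  qed
  have "core_sum X vs = (\<Sum>t\<in>ext (\<lambda>_. undefined) ({v} \<union> set us). walk_weight X t (t v) us (t v))"
    unfolding core_sum_def term_eq by (simp add: vs)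
  also have "\<dots> = (\<Sum>s\<in>ext (\<lambda>_. undefined) {v}. \<Sum>t\<in>ext s (set us). walk_weight X t (s v) us (s v))"
    using assms(1) vs by (subst sum_ext_Un) (auto simp: ext_def intro!: sum.cong)
  also have "\<dots> = (\<Sum>s\<in>ext (\<lambda>_. undefined) {v}. walk_sum X (Suc n) (s v) (s v))"
    using assms(1) vs us by (simp only: sum_walk_weight distinct.simps)
  also have "\<dots> = (\<Sum>x\<in>UNIV. walk_sum X (Suc n) x x)"
    using sum_prod_ext[of "{v}" "\<lambda>_ x. walk_sum X (Suc n) x x" "\<lambda>_. undefined"] by simp
  finally show ?thesis .
qed

text \<open>
  The characteristic polynomial of the matrix of \<open>walk_sum X 0\<close> is \<open>\<lambda> (\<lambda> - T) (\<lambda> + \<rho>)\<close>.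
\<close>

lemma walk_sum_trace:
  assumes X: "X Rd = \<rho>" "X Barred = - \<rho>" "X Free = T"
  shows "(\<Sum>x\<in>UNIV. walk_sum X n x x) = T ^ Suc n + (- \<rho>) ^ Suc n"
proof -
  \<comment> \<open>This is Cayley-Hamilton. As \<open>walk_sum X n\<close> is the power
    \<open>n + 1\<close>, the eigenvalue \<open>0\<close> leaves a recursion of order two that is
    valid from \<open>n = 0\<close> on.\<close>
  have rec: "walk_sum X (Suc (Suc n)) x y = (T - \<rho>) * walk_sum X (Suc n) x y + T * \<rho> * walk_sum X n x y" for n x y
  proof (induction n arbitrary: x)
    case 0
    show ?case
      by (cases x; cases y) (simp_all add: UNIV_mark X arc_weight_def algebra_simps)
  next
    case (Suc n)
    have "walk_sum X (Suc (Suc (Suc n))) x y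
       = (\<Sum>z\<in>UNIV. X x * fps_const (arc_weight x z) * ((T - \<rho>) * walk_sum X (Suc n) z y + T * \<rho> * walk_sum X n z y))"
      by (subst walk_sum.simps(2)) (simp only: Suc.IH)
    also have "\<dots> = (T - \<rho>) * walk_sum X (Suc (Suc n)) x y + T * \<rho> * walk_sum X (Suc n) x y"
      by (subst walk_sum.simps(2), subst (3) walk_sum.simps(2)) (simp add: sum_distrib_left sum.distrib algebra_simps)
    finally show ?case .
  qed
  show ?thesis
  proof (induction n rule: induct_nat_012)
    case (ge2 n)
    have "(\<Sum>x\<in>UNIV. walk_sum X (Suc (Suc n)) x x)
      = (T - \<rho>) * (\<Sum>x\<in>UNIV. walk_sum X (Suc n) x x) + T * \<rho> * (\<Sum>x\<in>UNIV. walk_sum X n x x)"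
      by (simp only: rec sum.distrib sum_distrib_left)
    also have "\<dots> = T ^ Suc (Suc (Suc n)) + (- \<rho>) ^ Suc (Suc (Suc n))"
      unfolding ge2 by (simp add: algebra_simps)
    finally show ?case .
  qed (simp_all add: UNIV_mark X arc_weight_def algebra_simps power2_eq_square)
qed

subsection \<open>Counting well-coloured unicircuit digraphs\<close>

definition unicircuits :: "'a set \<Rightarrow> 'a pair_pre_digraph set" where
  "unicircuits V = {D. pverts D = V \<and> unicircuit (with_proj D)}"

text \<open>These are the lists of length \<open>k\<close> from which \<open>D\<close> can be built
  as a core graph; length \<open>1\<close> is a root and thus reserved for trees.\<close>

definition cores :: "nat \<Rightarrow> 'a pair_pre_digraph \<Rightarrow> 'a list set" where
  "cores k D = {vs. length vs = k \<and> distinct vs \<and> set vs \<subseteq> pverts D \<and>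
     (if k = 1 then undirected_cycles (with_proj D) = {}
      else core_arcs vs \<in> undirected_cycles (with_proj D))}"

lemma finite_unicircuits:
  assumes "finite V"
  shows "finite (unicircuits V)"
proof (rule finite_subset)
  show "unicircuits V \<subseteq> (\<lambda>A. \<lparr>pverts = V, parcs = A\<rparr>) ` Pow (V \<times> V)"
  proof
    fix D assume "D \<in> unicircuits V"
    then have "pverts D = V" "parcs D \<subseteq> V \<times> V"
      by (auto simp: unicircuits_def unicircuit_def digraph_with_proj_iff)
    then show "D \<in> (\<lambda>A. \<lparr>pverts = V, parcs = A\<rparr>) ` Pow (V \<times> V)"
      by (intro image_eqI[of _ _ "parcs D"]) auto
  qed
qed (use assms in simp)

lemma finite_distinct_lists: "finite V \<Longrightarrow> finite {vs. length vs = k \<and> distinct vs \<and> set vs \<subseteq> V}"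
  by (rule finite_subset[OF _ finite_lists_length_eq[of V k]]) auto

lemma finite_cores: "finite (pverts D) \<Longrightarrow> finite (cores k D)"
  by (rule finite_subset[OF _ finite_distinct_lists[of "pverts D" k]]) (auto simp: cores_def)

text \<open>Pairs of a digraph and one of its cores correspond bijectively to triples
  \<open>(vs, f, b)\<close>.\<close>

lemma sum_core_graphs:
  fixes g :: "'a pair_pre_digraph \<Rightarrow> real"
  assumes V: "finite V" and k: "k \<ge> 1"
  shows "(\<Sum>D\<in>unicircuits V. real (card (cores k D)) * g D) =
    (\<Sum>vs | length vs = k \<and> distinct vs \<and> set vs \<subseteq> V. \<Sum>f\<in>forests V (set vs).
       \<Sum>b\<in>(V - set vs) \<rightarrow>\<^sub>E UNIV. g (core_graph V vs f b))"
proof -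
  let ?L = "{vs. length vs = k \<and> distinct vs \<and> set vs \<subseteq> V}"
  let ?F = "\<lambda>vs. forests V (set vs)" and ?O = "\<lambda>vs. (V - set vs) \<rightarrow>\<^sub>E (UNIV :: bool set)"
  let ?h = "\<lambda>(vs, f, b). (core_graph V vs f b, vs)"
  have fin: "finite ?L" "finite (?F vs)" "finite (?O vs)" for vs
    using V by (auto intro: finite_distinct_lists finite_forests finite_PiE)
  have "bij_betw ?h (Sigma ?L (\<lambda>vs. ?F vs \<times> ?O vs)) (Sigma (unicircuits V) (cores k))"
  proof (rule bij_betw_imageI)
    show "inj_on ?h (Sigma ?L (\<lambda>vs. ?F vs \<times> ?O vs))"
    proof (rule inj_onI)
      fix x y assume xy: "x \<in> Sigma ?L (\<lambda>vs. ?F vs \<times> ?O vs)" "y \<in> Sigma ?L (\<lambda>vs. ?F vs \<times> ?O vs)" "?h x = ?h y"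
      obtain vs f b where x: "x = (vs, f, b)" by (cases x)
      obtain vs' f' b' where y: "y = (vs', f', b')" by (cases y)
      from xy x y have vs': "vs' = vs" by simp
      with xy x y show "x = y"
        using core_graph_inj[of f V vs f' b b'] by simp
    qed
    show "?h ` Sigma ?L (\<lambda>vs. ?F vs \<times> ?O vs) = Sigma (unicircuits V) (cores k)"
    proof (intro equalityI subsetI)
      fix z assume "z \<in> ?h ` Sigma ?L (\<lambda>vs. ?F vs \<times> ?O vs)"
      then obtain vs f b where z: "z = (core_graph V vs f b, vs)" and vs: "length vs = k" "distinct vs" "set vs \<subseteq> V"
        and f: "f \<in> ?F vs" by auto
      have "vs \<noteq> []" using vs k by auto
      then show "z \<in> Sigma (unicircuits V) (cores k)"
        using unicircuit_core_graph[OF V vs(2) _ vs(3) f] undirected_cycles_core_graph[OF V vs(2) _ vs(3) f] vs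
        by (simp add: z unicircuits_def cores_def)
    next
      fix z assume "z \<in> Sigma (unicircuits V) (cores k)"
      then obtain D vs where z: "z = (D, vs)" and D: "pverts D = V" "unicircuit (with_proj D)" and vs: "vs \<in> cores k D"
        by (auto simp: unicircuits_def)
      have vs': "vs \<noteq> []" "distinct vs" "set vs \<subseteq> pverts D" "length vs = k"
        "if length vs = 1 then undirected_cycles (with_proj D) = {} else core_arcs vs \<in> undirected_cycles (with_proj D)"
        using vs k by (auto simp: cores_def)
      obtain f b where "f \<in> forests (pverts D) (set vs)" "b \<in> (pverts D - set vs) \<rightarrow>\<^sub>E UNIV"
        "D = core_graph (pverts D) vs f b"
        by (rule core_graph_exists[OF D(2) vs'(1-3,5)])
      with vs' show "z \<in> ?h ` Sigma ?L (\<lambda>vs. ?F vs \<times> ?O vs)"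
        unfolding D(1) by (intro image_eqI[of _ _ "(vs, f, b)"]) (auto simp: z D(1))
    qed
  qed
  then have "(\<Sum>(D, vs)\<in>Sigma (unicircuits V) (cores k). g D)
    = (\<Sum>(vs, f, b)\<in>Sigma ?L (\<lambda>vs. ?F vs \<times> ?O vs). g (core_graph V vs f b))"
    by (subst sum.reindex_bij_betw[symmetric]) (auto simp: case_prod_beta)
  moreover have "(\<Sum>(D, vs)\<in>Sigma (unicircuits V) (cores k). g D) = (\<Sum>D\<in>unicircuits V. real (card (cores k D)) * g D)"
    using V by (subst sum.Sigma[symmetric, OF finite_unicircuits]) (auto simp: unicircuits_def intro: finite_cores)
  moreover have "(\<Sum>(vs, f, b)\<in>Sigma ?L (\<lambda>vs. ?F vs \<times> ?O vs). g (core_graph V vs f b))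
    = (\<Sum>vs\<in>?L. \<Sum>f\<in>?F vs. \<Sum>b\<in>?O vs. g (core_graph V vs f b))"
    unfolding sum.cartesian_product by (rule sum.Sigma[symmetric]) (simp_all add: fin)
  ultimately show ?thesis by simp
qed

lemma unicircuit_cycle:
  assumes "unicircuit (with_proj D)" "undirected_cycles (with_proj D) \<noteq> {}"
  obtains vs where "distinct vs" "length vs \<ge> 2" "set vs \<subseteq> pverts D"
    "undirected_cycles (with_proj D) = {core_arcs vs}"
proof -
  obtain X where X: "X \<in> undirected_cycles (with_proj D)"
    using assms(2) by blast
  then have "undirected_cycles (with_proj D) = {X}" and circ: "X \<in> directed_circuits (with_proj D)"
    and dig: "digraph (with_proj D)"
    using assms(1) unfolding unicircuit_def by blast+
  obtain vs where "distinct vs" "length vs \<ge> 2" "set vs \<subseteq> pverts D" "core_arcs vs = X"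
    using directed_circuit_imp_core_arcs[OF circ dig] by blast
  with \<open>undirected_cycles (with_proj D) = {X}\<close> show thesis
    by (intro that[of vs]) simp_all
qed

text \<open>
  A cycle of length \<open>k \<ge> 2\<close> is the core of its \<open>k\<close> rotations; a tree has every single vertex as core.
\<close>

lemma sum_card_cores:
  assumes V: "finite V" "V \<noteq> {}" and D: "D \<in> unicircuits V"
  shows "(\<Sum>k=1..card V. real (card (cores k D)) / (if k = 1 then real (card V) else real k)) = 1"
proof -
  have D': "pverts D = V" "unicircuit (with_proj D)"
    using D by (auto simp: unicircuits_def)
  have n: "card V \<ge> 1" using V by (simp add: Suc_le_eq card_gt_0_iff)
  show ?thesis
  proof (cases "undirected_cycles (with_proj D) = {}")
    case True
    have c1: "cores 1 D = (\<lambda>v. [v]) ` V"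
      using True D' by (auto simp: cores_def length_Suc_conv)
    have "card (cores 1 D) = card V"
      unfolding c1 by (simp add: card_image inj_on_def)
    moreover have "cores k D = {}" if "k \<noteq> 1" for k
      using that True by (simp add: cores_def)
    ultimately have "(\<Sum>k=1..card V. real (card (cores k D)) / (if k = 1 then real (card V) else real k))
       = (\<Sum>k=1..card V. if k = 1 then 1 else 0)"
      using n by (intro sum.cong) auto
    also have "\<dots> = 1" using n by simp
    finally show ?thesis .
  next
    case False
    then obtain ws where ws: "distinct ws" "length ws \<ge> 2" "set ws \<subseteq> V"
      "undirected_cycles (with_proj D) = {core_arcs ws}"
      using unicircuit_cycle[OF D'(2)] D'(1) by metis
    let ?m = "length ws"
    have m: "?m \<le> card V" using ws V by (metis card_mono distinct_card)
    have set_eq: "set vs = fst ` core_arcs vs" if "length vs \<noteq> 1" for vs :: "'a list"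
    proof -
      have "fst ` core_arcs vs = set (map fst (zip vs (rotate1 vs)))"
        by (simp only: core_arcs_def if_not_P[OF that] set_map)
      then show ?thesis by (simp only: map_fst_zip length_rotate1)
    qed
    have cores_eq: "cores k D = (if k = ?m then {vs. distinct vs \<and> length vs = ?m \<and> core_arcs vs = core_arcs ws} else {})"
      for k
    proof -
      have "length vs = ?m" if "distinct vs" "length vs \<noteq> 1" "core_arcs vs = core_arcs ws" for vs
        using card_core_arcs[OF that(1,2)] card_core_arcs[OF ws(1)] ws(2) that(3) by simp
      moreover have "set vs \<subseteq> V" if "length vs = ?m" "core_arcs vs = core_arcs ws" for vs
        using set_eq[of vs] set_eq[of ws] that ws(2,3) by simp
      ultimately show ?thesis
        using ws(2,4) D'(1) unfolding cores_def by auto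
    qed
    have "card (cores k D) = (if k = ?m then ?m else 0)" for k
      unfolding cores_eq using card_core_arcs_rotations[OF ws(1,2)] by simp
    then have "(\<Sum>k=1..card V. real (card (cores k D)) / (if k = 1 then real (card V) else real k))
       = (\<Sum>k=1..card V. if k = ?m then 1 else 0)"
      using ws(2) by (intro sum.cong) auto
    also have "\<dots> = 1" using m ws(2) by simp
    finally show ?thesis .
  qed
qed

lemma card_distinct_lists:
  assumes "finite V" "k \<le> card V"
  shows "real (card {vs. length vs = k \<and> distinct vs \<and> set vs \<subseteq> V}) * fact (card V - k) = fact (card V)"
proof -
  have "card {vs. length vs = k \<and> distinct vs \<and> set vs \<subseteq> V} * fact (card V - k)
     = \<Prod>{card V - k + 1..card V} * fact (card V - k)"
    using card_lists_distinct_length_eq[OF assms] by simp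
  also have "\<dots> = fact (card V)"
    by (subst fact_div_fact[symmetric]) (simp_all add: fact_dvd)
  finally have "real (card {vs. length vs = k \<and> distinct vs \<and> set vs \<subseteq> V} * fact (card V - k)) = real (fact (card V))"
    by (simp only:)
  then show ?thesis by simp
qed

text \<open>The weight \<open>1\<close> of a digraph is spread over its cores: \<open>1/n\<close>
  for each root of a tree, \<open>1/k\<close> for each starting point on a circuit of length
  \<open>k\<close>. There are \<open>n!/(n - k)!\<close> lists of length \<open>k\<close>, and each
  contributes \<open>(n - k)!\<close> times the same coefficient of \<open>core_sum\<close>.\<close>

lemma num_wellcoloured_unicircuit_eq:
  fixes E X :: "mark \<Rightarrow> real fps"
  assumes E: "\<And>x. E x = fps_exp 1 oo (\<Sum>y\<in>UNIV. fps_const (edge_weight x y) * (fps_X * E y))"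
    and X: "\<And>x. X x = fps_X * (fps_const (mark_sign x) * E x)"
    and XT: "X Rd = \<rho>" "X Barred = - \<rho>" "X Free = T"
    and n: "n \<ge> 1"
  shows "real (num_wellcoloured_unicircuit n) / fact n
    = T $ n / real n + (\<Sum>k=2..n. (T ^ k + (- \<rho>) ^ k) $ n / real k)"
proof -
  let ?V = "{1..n}" and ?w = "\<lambda>D :: nat pair_pre_digraph. real (card {c. well_colouring (with_proj D) c})"
  define d where "d k = (if k = 1 then real n else real k)" for k :: nat
  \<comment> \<open>A single root has no arc to itself, so for \<open>k = 1\<close> all three marks
    are allowed and \<open>\<rho> - \<rho> + T = T\<close> replaces the trace
    \<open>T - \<rho>\<close>.\<close>
  define tr where "tr k = (if k = 1 then T else T ^ k + (- \<rho>) ^ k)" for k :: nat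
  have fin: "finite ?V" and ne: "?V \<noteq> {}" and card: "card ?V = n" using n by auto
  have tr: "core_sum X vs = tr k" if len: "length vs = k" and dist: "distinct vs" and k1: "k \<ge> 1" for k and vs :: "nat list"
  proof (cases "k = 1")
    case True
    then obtain v where "vs = [v]" using \<open>length vs = k\<close> by (auto simp: length_Suc_conv)
    then show ?thesis using True by (simp add: core_sum_single UNIV_mark XT tr_def)
  next
    case False
    then obtain m where "k = Suc (Suc m)" using k1 by (metis One_nat_def not0_implies_Suc not_one_le_zero)
    then show ?thesis
      using core_sum_cycle[of vs m X] walk_sum_trace[OF XT, of "Suc m"] len dist False by (simp only: tr_def if_False)
  qed
  have fin_wc: "\<forall>D\<in>unicircuits ?V. finite {c. well_colouring (with_proj D) c}"
  proof
    fix D assume "D \<in> unicircuits ?V"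
    then have "finite (pverts D)" by (simp add: unicircuits_def)
    then show "finite {c. well_colouring (with_proj D) c}" by (rule finite_well_colourings)
  qed
  have "{(D :: nat pair_pre_digraph, c). pverts D = ?V \<and> unicircuit (with_proj D) \<and> well_colouring (with_proj D) c}
     = Sigma (unicircuits ?V) (\<lambda>D. {c. well_colouring (with_proj D) c})"
    by (auto simp: unicircuits_def)
  then have "num_wellcoloured_unicircuit n = (\<Sum>D\<in>unicircuits ?V. card {c. well_colouring (with_proj D) c})"
    unfolding num_wellcoloured_unicircuit_def
    by (simp only: card_SigmaI[OF finite_unicircuits[OF fin] fin_wc])
  then have "real (num_wellcoloured_unicircuit n) = (\<Sum>D\<in>unicircuits ?V. ?w D)"
    by simp
  also have "\<dots> = (\<Sum>D\<in>unicircuits ?V. \<Sum>k=1..n. real (card (cores k D)) * ?w D / d k)"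
  proof (intro sum.cong refl)
    fix D :: "nat pair_pre_digraph" assume D: "D \<in> unicircuits ?V"
    have "(\<Sum>k=1..n. real (card (cores k D)) / d k) = 1"
      using sum_card_cores[OF fin ne D] unfolding card d_def .
    then have "?w D = (\<Sum>k=1..n. real (card (cores k D)) / d k) * ?w D" by simp
    also have "\<dots> = (\<Sum>k=1..n. real (card (cores k D)) * ?w D / d k)"
      by (simp add: sum_distrib_right)
    finally show "?w D = (\<Sum>k=1..n. real (card (cores k D)) * ?w D / d k)" .
  qed
  also have "\<dots> = (\<Sum>k=1..n. (\<Sum>D\<in>unicircuits ?V. real (card (cores k D)) * ?w D) / d k)"
    by (subst sum.swap) (simp add: sum_divide_distrib)
  also have "\<dots> = (\<Sum>k=1..n. fact n * tr k $ n / d k)"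
  proof (intro sum.cong refl arg_cong2[of _ _ _ _ "(/)"])
    fix k assume k: "k \<in> {1..n}"
    then have k1: "k \<ge> 1" by simp
    have "(\<Sum>D\<in>unicircuits ?V. real (card (cores k D)) * ?w D)
      = (\<Sum>vs | length vs = k \<and> distinct vs \<and> set vs \<subseteq> ?V. fact (n - k) * tr k $ n)"
      unfolding sum_core_graphs[OF fin k1]
    proof (intro sum.cong refl)
      fix vs assume "vs \<in> {vs. length vs = k \<and> distinct vs \<and> set vs \<subseteq> ?V}"
      then have vs: "length vs = k" "distinct vs" "set vs \<subseteq> ?V" by auto
      show "(\<Sum>f\<in>forests ?V (set vs). \<Sum>b\<in>(?V - set vs) \<rightarrow>\<^sub>E UNIV. ?w (core_graph ?V vs f b))
        = fact (n - k) * tr k $ n"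
        unfolding sum_forests_card_well_colourings[OF E X fin vs(2,3)] card vs(1) tr[OF vs(1,2) k1] ..
    qed
    also have "\<dots> = fact n * tr k $ n"
      using card_distinct_lists[OF fin, of k] k unfolding card by (simp add: mult.assoc[symmetric])
    finally show "(\<Sum>D\<in>unicircuits ?V. real (card (cores k D)) * ?w D) = fact n * tr k $ n" .
  qed
  also have "\<dots> = fact n * (\<Sum>k=1..n. tr k $ n / d k)"
    by (simp add: sum_distrib_left)
  also have "(\<Sum>k=1..n. tr k $ n / d k) = tr 1 $ n / d 1 + (\<Sum>k=2..n. tr k $ n / d k)"
    using n by (simp add: sum.atLeast_Suc_atMost numeral_2_eq_2)
  also have "\<dots> = T $ n / real n + (\<Sum>k=2..n. (T ^ k + (- \<rho>) ^ k) $ n / real k)"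
    by (simp add: tr_def d_def)
  finally show ?thesis by simp
qed

section \<open>Solution of the tree equations by the Cayley series\<close>

locale cayley_substitution =
  fixes T \<rho> :: "real fps"
  assumes T_def: "T = fps_const (1/2) * (cayley_fps oo (fps_const 2 * fps_X))"
    and rho_def: "\<rho> = - (cayley_fps oo (- T))"
begin

lemma T_0: "T $ 0 = 0"
  by (simp add: T_def cayley_fps_def fps_compose_nth_0)

lemma rho_0: "\<rho> $ 0 = 0"
  by (simp add: rho_def cayley_fps_def fps_compose_nth_0)

lemma T_eq: "T = fps_X * (fps_exp 1 oo (2 * T))"
proof -
  have "cayley_fps oo (fps_const 2 * fps_X) = 2 * T"
    by (simp add: T_def fps_numeral_fps_const flip: mult.assoc)
  with cayley_compose[of "fps_const 2 * fps_X"] have "2 * T = fps_const 2 * fps_X * (fps_exp 1 oo (2 * T))"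
    by simp
  then show ?thesis
    by (simp add: fps_numeral_fps_const[symmetric])
qed

lemma rho_eq: "\<rho> = T * (fps_exp 1 oo (- \<rho>))"
proof -
  have "(- T) $ 0 = 0" by (simp add: T_0)
  from arg_cong[OF cayley_compose[OF this], of uminus]
  have "- (cayley_fps oo (- T)) = T * (fps_exp 1 oo (cayley_fps oo (- T)))"
    by (simp only: mult_minus_left minus_minus)
  then show ?thesis
    unfolding rho_def minus_minus .
qed

text \<open>This solves the system for \<open>E\<close> in \<open>forest_sum\<close> with
  \<open>edge_weight\<close>. Below a free root the red and barred children cancel and leave the
  exponent \<open>2 T\<close>; below a red or barred root they leave \<open>- \<rho>\<close> in
  addition.\<close>

definition tree_exp :: "mark \<Rightarrow> real fps" where
  "tree_exp x = (if x = Free then fps_exp 1 oo (2 * T) else fps_exp 1 oo (2 * T - \<rho>))"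

definition tree_egf :: "mark \<Rightarrow> real fps" where
  "tree_egf x = fps_X * (fps_const (mark_sign x) * tree_exp x)"

lemma X_tree_exp: "fps_X * tree_exp x = (if x = Free then T else \<rho>)"
proof (cases "x = Free")
  case True
  then show ?thesis using T_eq by (simp add: tree_exp_def)
next
  case False
  have "fps_exp 1 oo (2 * T - \<rho>) = (fps_exp 1 oo (2 * T)) * (fps_exp 1 oo (- \<rho>))"
    using fps_exp_compose_add[of "2 * T" "- \<rho>"] T_0 rho_0 by simp
  then have "fps_X * tree_exp x = T * (fps_exp 1 oo (- \<rho>))"
    using False T_eq by (simp add: tree_exp_def mult.assoc[symmetric])
  then show ?thesis using rho_eq False by simp
qed

lemma tree_egf_simps: "tree_egf Rd = \<rho>" "tree_egf Barred = - \<rho>" "tree_egf Free = T"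
  using X_tree_exp[of Rd] X_tree_exp[of Barred] X_tree_exp[of Free]
  by (simp_all add: tree_egf_def mark_sign_def flip: fps_const_neg)

lemma tree_exp_eq:
  "tree_exp x = fps_exp 1 oo (\<Sum>y\<in>UNIV. fps_const (edge_weight x y) * (fps_X * tree_exp y))"
proof -
  have "(\<Sum>y\<in>UNIV. fps_const (edge_weight x y) * (fps_X * tree_exp y)) = (if x = Free then 2 * T else 2 * T - \<rho>)"
    unfolding X_tree_exp
    by (cases x) (simp_all add: UNIV_mark edge_weight_def mark_sign_def arc_weight_def
        fps_numeral_fps_const flip: fps_const_neg)
  then show ?thesis by (simp add: tree_exp_def)
qed

lemma unicircuit_egf_nth:
  "n \<ge> 1 \<Longrightarrow> unicircuit_egf $ n = T $ n / real n + (\<Sum>k=2..n. (T ^ k + (- \<rho>) ^ k) $ n / real k)"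
  using num_wellcoloured_unicircuit_eq[OF tree_exp_eq tree_egf_def tree_egf_simps]
  by (simp add: unicircuit_egf_def)

text \<open>Differentiating \<open>T = z exp (2 T)\<close> gives \<open>z T' = T + 2 T z T'\<close>,
  that is \<open>z (T - T^2)' = T\<close>.\<close>

lemma T_minus_square_nth: "n \<ge> 1 \<Longrightarrow> (T - T ^ 2) $ n = T $ n / real n"
proof -
  assume n: "n \<ge> 1"
  let ?G = "fps_exp 1 oo (2 * T)"
  have "fps_deriv T = ?G + fps_X * (?G * (2 * fps_deriv T))"
    by (subst T_eq) (simp add: fps_compose_deriv T_0)
  then have "fps_X * fps_deriv T = fps_X * ?G + fps_X * ?G * (2 * (fps_X * fps_deriv T))"
    by (metis (no_types, opaque_lifting) distrib_left mult.assoc mult.left_commute)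
  then have *: "fps_X * fps_deriv T = T + T * (2 * (fps_X * fps_deriv T))"
    by (simp only: T_eq[symmetric])
  have "fps_X * fps_deriv (T - T ^ 2) = fps_X * fps_deriv T - T * (2 * (fps_X * fps_deriv T))"
    by (simp add: power2_eq_square algebra_simps)
  also have "\<dots> = T" using * unfolding diff_eq_eq .
  finally have "(fps_X * fps_deriv (T - T ^ 2)) $ n = T $ n" by simp
  then show ?thesis
    using n by (simp add: fps_X_mult_nth field_simps del: fps_deriv_sub)
qed

lemma unicircuit_egf_eq: "unicircuit_egf = \<rho> - T ^ 2 - fps_log (1 - T) - fps_log (1 + \<rho>)"
proof (rule fps_ext)
  fix n
  show "unicircuit_egf $ n = (\<rho> - T ^ 2 - fps_log (1 - T) - fps_log (1 + \<rho>)) $ n"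
  proof (cases "n = 0")
    case True
    then show ?thesis
      by (simp add: unicircuit_egf_def T_0 rho_0 fps_log_nth_0 power2_eq_square)
  next
    case False
    then have n: "n \<ge> 1" by simp
    have logs: "- fps_log (1 - T) $ n = (\<Sum>k=1..n. (T ^ k) $ n / real k)"
      "- fps_log (1 + \<rho>) $ n = (\<Sum>k=1..n. ((- \<rho>) ^ k) $ n / real k)"
      using fps_log_one_minus_nth[of T n] fps_log_one_minus_nth[of "- \<rho>" n] T_0 rho_0 by simp_all
    have split: "(\<Sum>k=1..n. h k) = h 1 + (\<Sum>k=2..n. h k)" for h :: "nat \<Rightarrow> real"
      using n by (simp add: sum.atLeast_Suc_atMost numeral_2_eq_2)
    \<comment> \<open>The logarithms contain the terms \<open>T\<close> and \<open>- \<rho>\<close>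
      for \<open>k = 1\<close>, which do not occur in the count; hence \<open>T - \<rho>\<close> is
      subtracted.\<close>
    have "(\<rho> - T ^ 2 - fps_log (1 - T) - fps_log (1 + \<rho>)) $ n
      = (T - T ^ 2) $ n - (T $ n - \<rho> $ n) + - fps_log (1 - T) $ n + - fps_log (1 + \<rho>) $ n"
      by simp
    also have "\<dots> = T $ n / real n + (\<Sum>k=2..n. (T ^ k + (- \<rho>) ^ k) $ n / real k)"
      unfolding logs split T_minus_square_nth[OF n] by (simp add: sum.distrib add_divide_distrib)
    finally show ?thesis using unicircuit_egf_nth[OF n] by simp
  qed
qed

section \<open>The first coefficients\<close>

lemma T_nth: "T $ n = (if n = 0 then 0 else (2 * real n) ^ (n - 1) / fact n)"
  by (cases n) (simp_all add: T_def fps_compose_linear cayley_fps_def flip: power_mult_distrib)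

text \<open>Differentiating \<open>\<rho> = T exp (- \<rho>)\<close> and eliminating the exponential
  leaves an equation from which the coefficients of \<open>\<rho>\<close> can be computed
  recursively.\<close>

lemma rho_ode: "T * (fps_deriv \<rho> * (1 + \<rho>)) = fps_deriv T * \<rho>"
proof -
  let ?G = "fps_exp 1 oo (- \<rho>)"
  have "fps_deriv \<rho> = fps_deriv T * ?G - T * ?G * fps_deriv \<rho>"
    by (subst rho_eq) (simp add: fps_compose_deriv rho_0)
  then have "fps_deriv \<rho> = fps_deriv T * ?G - \<rho> * fps_deriv \<rho>"
    by (simp only: rho_eq[symmetric])
  then have "fps_deriv \<rho> * (1 + \<rho>) = fps_deriv T * ?G"
    by (simp add: algebra_simps)
  then have "T * (fps_deriv \<rho> * (1 + \<rho>)) = fps_deriv T * (T * ?G)"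
    by (simp add: mult_ac)
  then show ?thesis
    by (simp only: rho_eq[symmetric])
qed

lemmas fps_mult_nth_expand =
  fps_mult_nth atLeast0AtMost atMost_nat_numeral atMost_Suc numeral_2_eq_2[symmetric]

lemma rho_nth:
  "\<rho> $ Suc 0 = 1" "\<rho> $ 2 = 1"
  "\<rho> $ 3 = 7/2"
  "\<rho> $ 4 = 35/3"
  "\<rho> $ 5 = 1093/24"
  "\<rho> $ 6 = 11213/60"
  "\<rho> $ 7 = 578779/720"
proof -
  \<comment> \<open>The lowest coefficients of \<open>rho_ode\<close> are trivial identities, so the
    first coefficient of \<open>\<rho>\<close> comes from the functional equation.\<close>
  have "(T * (fps_exp 1 oo (- \<rho>))) $ 1 = 1"
    by (simp add: fps_mult_nth T_nth rho_0)
  then show 1: "\<rho> $ Suc 0 = 1"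
    using rho_eq by simp
  show 2: "\<rho> $ 2 = 1"
    using arg_cong[OF rho_ode, of "\<lambda>F. F $ 2"] 1
    by (simp add: fps_mult_nth_expand T_nth rho_0 fact_numeral)
  show 3: "\<rho> $ 3 = 7/2"
    using arg_cong[OF rho_ode, of "\<lambda>F. F $ 3"] 1 2
    by (simp add: fps_mult_nth_expand T_nth rho_0 fact_numeral)
  show 4: "\<rho> $ 4 = 35/3"
    using arg_cong[OF rho_ode, of "\<lambda>F. F $ 4"] 1 2 3
    by (simp add: fps_mult_nth_expand T_nth rho_0 fact_numeral)
  show 5: "\<rho> $ 5 = 1093/24"
    using arg_cong[OF rho_ode, of "\<lambda>F. F $ 5"] 1 2 3 4
    by (simp add: fps_mult_nth_expand T_nth rho_0 fact_numeral)
  show 6: "\<rho> $ 6 = 11213/60"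
    using arg_cong[OF rho_ode, of "\<lambda>F. F $ 6"] 1 2 3 4 5
    by (simp add: fps_mult_nth_expand T_nth rho_0 fact_numeral)
  show 7: "\<rho> $ 7 = 578779/720"
    using arg_cong[OF rho_ode, of "\<lambda>F. F $ 7"] 1 2 3 4 5 6
    by (simp add: fps_mult_nth_expand T_nth rho_0 fact_numeral)
qed

text \<open>This is \<open>T_g + T * T_r\<close>, with \<open>\<rho>\<close> for
  \<open>T_r\<close>.\<close>

definition log_arg :: "real fps" where
  "log_arg = T - \<rho> + T * \<rho>"

lemma one_minus_log_arg: "1 - log_arg = (1 - T) * (1 + \<rho>)"
  by (simp add: log_arg_def algebra_simps)

lemma log_arg_nth:
  "log_arg $ 0 = 0" "log_arg $ Suc 0 = 0"
  "log_arg $ 2 = 2"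
  "log_arg $ 3 = 11/2"
  "log_arg $ 4 = 127/6"
  "log_arg $ 5 = 2011/24"
  "log_arg $ 6 = 42391/120"
  "log_arg $ 7 = 123333/80"
  by (simp_all add: log_arg_def fps_mult_nth_expand T_nth rho_0 rho_nth fact_numeral)

lemma fps_log_log_arg: "fps_log (1 - log_arg) = fps_log (1 - T) + fps_log (1 + \<rho>)"
  unfolding one_minus_log_arg by (rule fps_log_mult) (simp_all add: T_0 rho_0)

text \<open>The logarithm \<open>L\<close> satisfies \<open>(1 - log_arg) L' = - log_arg'\<close>;
  the coefficient of index \<open>n\<close> in this equation yields the coefficient of index
  \<open>n + 1\<close> of \<open>L\<close> from the earlier ones.\<close>

lemma fps_log_log_arg_nth:
  "fps_log (1 - log_arg) $ Suc 0 = - (0)"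
  "fps_log (1 - log_arg) $ 2 = - (2)"
  "fps_log (1 - log_arg) $ 3 = - (11/2)"
  "fps_log (1 - log_arg) $ 4 = - (139/6)"
  "fps_log (1 - log_arg) $ 5 = - (2275/24)"
  "fps_log (1 - log_arg) $ 6 = - (24803/60)"
  "fps_log (1 - log_arg) $ 7 = - (147813/80)"
proof -
  let ?L = "fps_log (1 - log_arg)"
  have "(1 - log_arg) * fps_deriv ?L = - fps_deriv log_arg"
    using inverse_mult_eq_1'[of "1 - log_arg"]
    by (simp add: fps_log_deriv log_arg_nth mult.left_commute)
  then have ode: "((1 - log_arg) * fps_deriv ?L) $ n = - fps_deriv log_arg $ n" for n
    by simp
  show 1: "?L $ Suc 0 = - (0)"
    using ode[of 0] 
    by (simp add: fps_mult_nth_expand log_arg_nth)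
  show 2: "?L $ 2 = - (2)"
    using ode[of 1] 1
    by (simp add: fps_mult_nth_expand log_arg_nth)
  show 3: "?L $ 3 = - (11/2)"
    using ode[of 2] 1 2
    by (simp add: fps_mult_nth_expand log_arg_nth)
  show 4: "?L $ 4 = - (139/6)"
    using ode[of 3] 1 2 3
    by (simp add: fps_mult_nth_expand log_arg_nth)
  show 5: "?L $ 5 = - (2275/24)"
    using ode[of 4] 1 2 3 4
    by (simp add: fps_mult_nth_expand log_arg_nth)
  show 6: "?L $ 6 = - (24803/60)"
    using ode[of 5] 1 2 3 4 5
    by (simp add: fps_mult_nth_expand log_arg_nth)
  show 7: "?L $ 7 = - (147813/80)"
    using ode[of 6] 1 2 3 4 5 6
    by (simp add: fps_mult_nth_expand log_arg_nth)
qed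

lemma unicircuit_egf_eq_log_arg: "unicircuit_egf = \<rho> - T ^ 2 - fps_log (1 - log_arg)"
  by (simp add: unicircuit_egf_eq fps_log_log_arg algebra_simps)

lemma unicircuit_egf_nth_small:
  "unicircuit_egf $ 0 = 0"
  "unicircuit_egf $ Suc 0 = 1"
  "unicircuit_egf $ 2 = 4 / fact 2"
  "unicircuit_egf $ 3 = 30 / fact 3"
  "unicircuit_egf $ 4 = 452 / fact 4"
  "unicircuit_egf $ 5 = 8840 / fact 5"
  "unicircuit_egf $ 6 = 224832 / fact 6"
  "unicircuit_egf $ 7 = 6909784 / fact 7"
  by (simp_all add: unicircuit_egf_eq_log_arg fps_log_log_arg_nth fps_log_nth_0 power2_eq_square
      fps_mult_nth_expand T_nth rho_0 rho_nth fact_numeral)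

text \<open>The remainder is the series shifted by \<open>8\<close>, so comparing eight coefficients
  suffices.\<close>

lemma unicircuit_egf_expansion:
  "unicircuit_egf = fps_X
          + fps_const (4 / fact 2) * fps_X ^ 2
          + fps_const (30 / fact 3) * fps_X ^ 3
          + fps_const (452 / fact 4) * fps_X ^ 4
          + fps_const (8840 / fact 5) * fps_X ^ 5
          + fps_const (224832 / fact 6) * fps_X ^ 6
          + fps_const (6909784 / fact 7) * fps_X ^ 7
          + fps_X ^ 8 * fps_shift 8 unicircuit_egf" (is "_ = ?P + _")
proof -
  have "fps_cutoff 8 unicircuit_egf = ?P"
  proof (rule fps_ext)
    fix n :: nat
    consider "n \<in> {0, 1, 2, 3, 4, 5, 6, 7}" | "n \<ge> 8"
      unfolding insert_iff empty_iff by linarith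
    then show "fps_cutoff 8 unicircuit_egf $ n = ?P $ n"
    proof cases
      case 1
      then show ?thesis
        by (elim insertE emptyE) (simp_all add: unicircuit_egf_nth_small)
    qed simp
  qed
  then show ?thesis
    using fps_shift_cutoff[of 8 unicircuit_egf] by (simp add: add.commute mult.commute)
qed

end

theorem theorem3:
  fixes U C C2 T T_r T_g T_unr :: "real fps"
  assumes "U = unicircuit_egf"
    and "C = cayley_fps"
    and "C2 = C oo (fps_const 2 * fps_X)"
    and "T = fps_const (1/2) * C2"
    and "T_r = - (C oo (- (fps_const (1/2) * C2)))"
    and "T_g = T - T_r"
    and "T_unr = T - T ^ 2"
  shows "C = fps_X * (fps_exp 1 oo C)
    \<and> U = T_unr - T_g + fps_log (1 / (1 - (T_g + T * T_r)))
    \<and> U = - (fps_const (1/4) * C2 ^ 2) - (C oo (- (fps_const (1/2) * C2)))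
          - fps_log (1 - fps_const (1/2) * C2 - (C oo (- (fps_const (1/2) * C2)))
                     + (C oo (- (fps_const (1/2) * C2))) * (fps_const (1/2) * C2))
    \<and> (\<exists>R. U = fps_X
          + fps_const (4 / fact 2) * fps_X ^ 2
          + fps_const (30 / fact 3) * fps_X ^ 3
          + fps_const (452 / fact 4) * fps_X ^ 4
          + fps_const (8840 / fact 5) * fps_X ^ 5
          + fps_const (224832 / fact 6) * fps_X ^ 6
          + fps_const (6909784 / fact 7) * fps_X ^ 7
          + fps_X ^ 8 * R)"
proof (intro conjI)
  interpret cayley_substitution T T_r
    by unfold_locales (simp_all add: assms)
  have T: "fps_const (1/2) * C2 = T"
    by (simp add: assms(4))
  have C_T: "C oo (- T) = - T_r"
    unfolding assms(4,5) by (rule minus_minus[symmetric])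
  have U: "U = T_r - T ^ 2 - fps_log (1 - log_arg)"
    using unicircuit_egf_eq_log_arg by (simp only: assms(1))
  show "C = fps_X * (fps_exp 1 oo C)"
    unfolding assms(2) by (rule cayley_fps_eq)
  have "T_g + T * T_r = log_arg"
    by (simp add: log_arg_def assms(6))
  moreover have "fps_log (1 / (1 - log_arg)) = - fps_log (1 - log_arg)"
    by (rule fps_log_divide) (simp add: log_arg_nth)
  ultimately show "U = T_unr - T_g + fps_log (1 / (1 - (T_g + T * T_r)))"
    unfolding U assms(6,7) by simp
  have arg: "1 - T - (- T_r) + (- T_r) * T = 1 - log_arg"
    by (simp add: log_arg_def algebra_simps)
  have square: "fps_const (1/4) * C2 ^ 2 = T ^ 2"
    unfolding T[symmetric] by (simp add: power_mult_distrib power_divide)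
  show "U = - (fps_const (1/4) * C2 ^ 2) - (C oo (- (fps_const (1/2) * C2)))
          - fps_log (1 - fps_const (1/2) * C2 - (C oo (- (fps_const (1/2) * C2)))
                     + (C oo (- (fps_const (1/2) * C2))) * (fps_const (1/2) * C2))"
    unfolding T C_T U arg square by simp
  show "\<exists>R. U = fps_X
          + fps_const (4 / fact 2) * fps_X ^ 2
          + fps_const (30 / fact 3) * fps_X ^ 3
          + fps_const (452 / fact 4) * fps_X ^ 4
          + fps_const (8840 / fact 5) * fps_X ^ 5
          + fps_const (224832 / fact 6) * fps_X ^ 6
          + fps_const (6909784 / fact 7) * fps_X ^ 7
          + fps_X ^ 8 * R"
    unfolding assms(1) using unicircuit_egf_expansion by (rule exI)
qed

end
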